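(* Let $n\ge3$ and let $$w=h_{n-1}(j_1,i_1)a_n\,h_{n-1}(j_2,i_2)a_n\cdots h_{n-1}(j_m,i_m)a_n\,x\qquad(m\ge1)$$ be the canonical reduced expression of an element $w\in W(\tilde A_{n-1})$, where $x$ is the canonical reduced expression of an element of $W(A_{n-1})$. Substituting $\sigma_na_{n+1}\sigma_n$ for $a_n$ in this expression produces a reduced expression which can be transformed into the canonical reduced expression of $R_n(w)$, which has the following shape: $$R_n(w)=h_n(j_1,i_1)a_{n+1}\,h_n(j_2,i'_2)a_{n+1}\cdots h_n(j_m,i'_m)a_{n+1}\,\lfloor t,n\rfloor\,x,$$ where, letting $s=\max\{k: 1\le k\le m,\ i_k<n-k\}$, we have $$i'_k=i_k\ \text{ for } k\le s,\qquad i'_k=i_k+1\ \text{ for } k>s,\qquad t=n-s+1.$$ This implies $$L(R_n(w))=L(w),\qquad l(R_n(w))=l(w)+2L(w),$$ hence replacing $a_n$ by $\sigma_na_{n+1}\sigma_n$ in a reduced expression for $w$ produces a reduced expression for $R_n(w)$ if and only if the expression for $w$ is affine length reduced.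
   Context: For $N\ge2$, $W(\tilde A_N)$ is the Coxeter group with generating set $S_N=\{\sigma_1,\dots,\sigma_N,a_{N+1}\}$ whose Coxeter graph is the cycle $\sigma_1-\sigma_2-\cdots-\sigma_N-a_{N+1}-\sigma_1$ (all edges of label 3). $W(A_N)$ is the parabolic subgroup generated by $\sigma_1,\dots,\sigma_N$; $l$ is the Coxeter length (in the group considered). The affine length $L(w)$ of $w\in W(\tilde A_N)$ is the minimal number of occurrences of $a_{N+1}$ among all reduced expressions of $w$; a reduced expression is affine length reduced if $a_{N+1}$ occurs in it exactly $L(w)$ times. Notation (words): $\lfloor i,j\rfloor=\sigma_i\sigma_{i+1}\cdots\sigma_j$ for $i\le j$; $\lceil i,j\rceil=\sigma_i\sigma_{i-1}\cdots\sigma_j$ for $i\ge j$; $\lfloor N+1,N\rfloor=1$, $\lceil 0,1\rceil=1$. For $1\le r\le N+1$, $0\le i\le N-1$: $h_N(r,i)=\lfloor r,N\rfloor\lceil i,1\rceil$. The canonical reduced expression of an element of $W(A_N)$ is its unique expression $\lfloor k_1,l_1\rfloor\cdots\lfloor k_t,l_t\rfloor$ with $t\ge0$, $N\ge l_1>\cdots>l_t\ge1$, $l_h\ge k_h\ge1$. The canonical reduced expression of an element $w\in W(\tilde A_N)$ with $L(w)=m\ge1$ is its unique expression $h_N(j_1,i_1)a_{N+1}\cdots h_N(j_m,i_m)a_{N+1}\,x$ where $x$ is the canonical reduced expression of an element of $W(A_N)$ and $(j_s,i_s)_{1\le s\le m}$ satisfies the pairwise inequalities (for $N$): (i) $1\le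 j_1\le N+1$, $0\le i_1\le N-1$; (ii) for $2\le s\le m$, either $i_s=0$ and $j_s=1$, or $1\le i_s\le N-1$ and $1\le j_s\le N$; (iii) for $2\le s\le m$, $j_s\le j_{s-1}$ and $i_s\ge i_{s-1}$; (iv) for $2\le s\le m$, if $j_{s-1}>i_{s-1}+1$ then $j_s<j_{s-1}$; (v) for $2\le s\le m$, if $j_s>i_s+1$ then $i_s>i_{s-1}$. (Existence, uniqueness and reducedness of this expression hold for every $N\ge2$.) $R_n:W(\tilde A_{n-1})\to W(\tilde A_n)$ is the group monomorphism with $R_n(\sigma_i)=\sigma_i$ for $1\le i\le n-1$ and $R_n(a_n)=\sigma_na_{n+1}\sigma_n$. *)

theory Defs
  imports "HOL-Algebra.Group"
begin

section \<open>Coxeter groups given by a Coxeter matrix\<close>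

text \<open>
  The Coxeter group of a matrix \<open>M\<close> on a set \<open>S\<close> of generators is built as the set of words over \<open>S\<close>
  modulo the congruence generated by \<open>(s t)^(M s t) = 1\<close>. The entry \<open>0\<close> encodes infinity (no
  relation). Since \<open>M s s = 1\<close> makes every generator an involution, no formal inverses are needed.
\<close>

inductive cox_eq :: "'a set \<Rightarrow> ('a \<Rightarrow> 'a \<Rightarrow> nat) \<Rightarrow> 'a list \<Rightarrow> 'a list \<Rightarrow> bool"
  for S :: "'a set" and M :: "'a \<Rightarrow> 'a \<Rightarrow> nat" where
  cox_rel: "\<lbrakk>s \<in> S; t \<in> S; u \<in> lists S; v \<in> lists S\<rbrakk>
              \<Longrightarrow> cox_eq S M (u @ concat (replicate (M s t) [s, t]) @ v) (u @ v)"
| cox_refl: "u \<in> lists S \<Longrightarrow> cox_eq S M u u"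
| cox_sym: "cox_eq S M u v \<Longrightarrow> cox_eq S M v u"
| cox_trans: "cox_eq S M u v \<Longrightarrow> cox_eq S M v w \<Longrightarrow> cox_eq S M u w"

definition cox_class :: "'a set \<Rightarrow> ('a \<Rightarrow> 'a \<Rightarrow> nat) \<Rightarrow> 'a list \<Rightarrow> 'a list set" where
  "cox_class S M u = {v. cox_eq S M u v}"

definition coxeter_group :: "'a set \<Rightarrow> ('a \<Rightarrow> 'a \<Rightarrow> nat) \<Rightarrow> 'a list set monoid" where
  "coxeter_group S M =
     \<lparr>carrier = cox_class S M ` lists S,
      mult = (\<lambda>g h. \<Union>u\<in>g. \<Union>v\<in>h. cox_class S M (u @ v)),
      one = cox_class S M []\<rparr>"

text \<open>A group element is the set of all words expressing it, so \<open>u \<in> g\<close> says that \<open>u\<close> is an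
  expression of \<open>g\<close>.\<close>

definition cox_length :: "'a list set \<Rightarrow> nat" where
  "cox_length g = (LEAST k. \<exists>u\<in>g. length u = k)"

definition reduced_expression :: "'a list set \<Rightarrow> 'a list \<Rightarrow> bool" where
  "reduced_expression g u \<longleftrightarrow> u \<in> g \<and> length u = cox_length g"

fun alternating :: "'a \<Rightarrow> 'a \<Rightarrow> nat \<Rightarrow> 'a list" where
  "alternating s t 0 = []"
| "alternating s t (Suc k) = s # alternating t s k"

inductive braid_move :: "'a set \<Rightarrow> ('a \<Rightarrow> 'a \<Rightarrow> nat) \<Rightarrow> 'a list \<Rightarrow> 'a list \<Rightarrow> bool"
  for S :: "'a set" and M :: "'a \<Rightarrow> 'a \<Rightarrow> nat" where
  "\<lbrakk>s \<in> S; t \<in> S; s \<noteq> t; M s t \<noteq> 0; u \<in> lists S; v \<in> lists S\<rbrakk>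
     \<Longrightarrow> braid_move S M (u @ alternating s t (M s t) @ v) (u @ alternating t s (M s t) @ v)"

section \<open>The affine Coxeter group of type A\<close>

text \<open>
  \<open>Sig i\<close> is the generator \<open>\<sigma>\<^sub>i\<close>; \<open>Aff\<close> is the affine generator, i.e. \<open>a\<^sub>N\<^sub>+\<^sub>1\<close> when words are read in
  the group of rank parameter \<open>N\<close>. The same symbol thus stands for different generators in the
  groups for \<open>n - 1\<close> and \<open>n\<close>; the substitution below makes the passage between them explicit.
\<close>

datatype gen = Sig nat | Aff

definition gens :: "nat \<Rightarrow> gen set" where
  "gens N = insert Aff (Sig ` {1..N})"

definition cycle_step :: "nat \<Rightarrow> gen \<Rightarrow> gen \<Rightarrow> bool" where
  "cycle_step N s t \<longleftrightarrow>
     (\<exists>i. 1 \<le> i \<and> i < N \<and> s = Sig i \<and> t = Sig (i + 1)) \<or>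
     (s = Sig N \<and> t = Aff) \<or> (s = Aff \<and> t = Sig 1)"

definition affine_matrix :: "nat \<Rightarrow> gen \<Rightarrow> gen \<Rightarrow> nat" where
  "affine_matrix N s t =
     (if s = t then 1 else if cycle_step N s t \<or> cycle_step N t s then 3 else 2)"

definition affine_group :: "nat \<Rightarrow> gen list set monoid" where
  "affine_group N = coxeter_group (gens N) (affine_matrix N)"

definition word_class :: "nat \<Rightarrow> gen list \<Rightarrow> gen list set" where
  "word_class N u = cox_class (gens N) (affine_matrix N) u"

definition affine_length :: "gen list set \<Rightarrow> nat" where
  "affine_length g = (LEAST k. \<exists>u. reduced_expression g u \<and> count_list u Aff = k)"

definition affine_length_reduced :: "gen list set \<Rightarrow> gen list \<Rightarrow> bool" where
  "affine_length_reduced g u \<longleftrightarrow> reduced_expression g u \<and> count_list u Aff = affine_length g"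

section \<open>Canonical expressions\<close>

text \<open>The words \<open>\<sigma>\<^sub>i \<sigma>\<^sub>i\<^sub>+\<^sub>1 \<dots> \<sigma>\<^sub>j\<close> and \<open>\<sigma>\<^sub>i \<sigma>\<^sub>i\<^sub>-\<^sub>1 \<dots> \<sigma>\<^sub>j\<close>; the conventions that the former is empty for
  \<open>(i, j) = (N + 1, N)\<close> and the latter for \<open>(i, j) = (0, 1)\<close> are built in.\<close>

definition up_word :: "nat \<Rightarrow> nat \<Rightarrow> gen list" where
  "up_word i j = map Sig [i..<Suc j]"

definition down_word :: "nat \<Rightarrow> nat \<Rightarrow> gen list" where
  "down_word i j = map Sig (rev [j..<Suc i])"

definition h_word :: "nat \<Rightarrow> nat \<Rightarrow> nat \<Rightarrow> gen list" where
  "h_word N r i = up_word r N @ down_word i 1"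

definition canonical_finite :: "nat \<Rightarrow> gen list \<Rightarrow> bool" where
  "canonical_finite N x \<longleftrightarrow>
     (\<exists>kls. x = concat (map (\<lambda>(k, l). up_word k l) kls) \<and>
        (\<forall>(k, l)\<in>set kls. 1 \<le> k \<and> k \<le> l \<and> l \<le> N) \<and>
        sorted_wrt (\<lambda>p q. snd p > snd q) kls)"

definition pairwise_inequalities :: "nat \<Rightarrow> nat \<Rightarrow> (nat \<Rightarrow> nat) \<Rightarrow> (nat \<Rightarrow> nat) \<Rightarrow> bool" where
  "pairwise_inequalities N m j i \<longleftrightarrow>
     1 \<le> j 1 \<and> j 1 \<le> N + 1 \<and> i 1 \<le> N - 1 \<and>
     (\<forall>s\<in>{2..m}.
        ((i s = 0 \<and> j s = 1) \<or> (1 \<le> i s \<and> i s \<le> N - 1 \<and> 1 \<le> j s \<and> j s \<le> N)) \<and>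
        j s \<le> j (s - 1) \<and> i (s - 1) \<le> i s \<and>
        (j (s - 1) > i (s - 1) + 1 \<longrightarrow> j s < j (s - 1)) \<and>
        (j s > i s + 1 \<longrightarrow> i (s - 1) < i s))"

definition affine_word :: "nat \<Rightarrow> nat \<Rightarrow> (nat \<Rightarrow> nat) \<Rightarrow> (nat \<Rightarrow> nat) \<Rightarrow> gen list \<Rightarrow> gen list" where
  "affine_word N m j i x = concat (map (\<lambda>k. h_word N (j k) (i k) @ [Aff]) [1..<Suc m]) @ x"

text \<open>\<open>canonical_expression N g m j i x\<close>: the word \<open>affine_word N m j i x\<close> is the canonical reduced
  expression of \<open>g\<close>, an element of affine length \<open>m \<ge> 1\<close>. That such words are always reduced is a
  theorem and not part of the definition.\<close>

definition canonical_expression ::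
    "nat \<Rightarrow> gen list set \<Rightarrow> nat \<Rightarrow> (nat \<Rightarrow> nat) \<Rightarrow> (nat \<Rightarrow> nat) \<Rightarrow> gen list \<Rightarrow> bool" where
  "canonical_expression N g m j i x \<longleftrightarrow>
     1 \<le> m \<and> affine_length g = m \<and> affine_word N m j i x \<in> g \<and>
     pairwise_inequalities N m j i \<and> canonical_finite N x"

section \<open>The embedding of consecutive affine groups\<close>

definition subst_word :: "nat \<Rightarrow> gen list \<Rightarrow> gen list" where
  "subst_word n u =
     concat (map (\<lambda>s. if s = Aff then [Sig n, Aff, Sig n] else [s]) u)"

text \<open>\<open>affine_embedding n\<close> is \<open>R\<^sub>n\<close>. The union ranges over all expressions of \<open>g\<close>; the classes united all coincide
  by \<open>affine_embedding_word_class\<close>.\<close>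

definition affine_embedding :: "nat \<Rightarrow> gen list set \<Rightarrow> gen list set" where
  "affine_embedding n g = (\<Union>u\<in>g. word_class n (subst_word n u))"

section \<open>Well-definedness\<close>

lemma cox_eq_lists: "cox_eq S M u v \<Longrightarrow> u \<in> lists S \<and> v \<in> lists S"
proof (induction rule: cox_eq.induct)
  case (cox_rel s t u v)
  then show ?case by (auto simp: in_lists_conv_set)
qed auto

lemma cox_eq_context:
  "cox_eq S M u v \<Longrightarrow> p \<in> lists S \<Longrightarrow> q \<in> lists S \<Longrightarrow> cox_eq S M (p @ u @ q) (p @ v @ q)"
proof (induction rule: cox_eq.induct)
  case (cox_rel s t u v)
  then show ?case using cox_eq.cox_rel[of s S t "p @ u" "v @ q" M] by simp
next
  case (cox_refl u)
  then show ?case by (intro cox_eq.cox_refl) auto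
next
  case (cox_sym u v)
  show ?case by (rule cox_eq.cox_sym) (rule cox_sym.IH[OF cox_sym.prems])
next
  case (cox_trans u v w)
  show ?case
    by (rule cox_eq.cox_trans[OF cox_trans.IH(1)[OF cox_trans.prems] cox_trans.IH(2)[OF cox_trans.prems]])
qed

lemma cox_eq_append:
  assumes "cox_eq S M u u'" "cox_eq S M v v'"
  shows "cox_eq S M (u @ v) (u' @ v')"
proof -
  have "cox_eq S M (u @ v) (u' @ v)"
    using cox_eq_context[OF assms(1), of "[]" v] cox_eq_lists[OF assms(2)] by simp
  moreover have "cox_eq S M (u' @ v) (u' @ v')"
    using cox_eq_context[OF assms(2), of u' "[]"] cox_eq_lists[OF assms(1)] by simp
  ultimately show ?thesis by (rule cox_trans)
qed

lemma cox_class_eqI: "cox_eq S M u v \<Longrightarrow> cox_class S M u = cox_class S M v"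
  unfolding cox_class_def
  by (rule Collect_cong, rule iffI) (erule cox_trans[OF cox_sym], assumption, erule cox_trans)

lemma cox_class_mult:
  assumes "u \<in> lists S" "v \<in> lists S"
  shows "cox_class S M u \<otimes>\<^bsub>coxeter_group S M\<^esub> cox_class S M v = cox_class S M (u @ v)"
proof -
  have "cox_class S M (u' @ v') = cox_class S M (u @ v)"
    if "u' \<in> cox_class S M u" "v' \<in> cox_class S M v" for u' v'
  proof -
    have "cox_eq S M (u @ v) (u' @ v')"
      using that by (intro cox_eq_append) (simp_all add: cox_class_def)
    from cox_class_eqI[OF this] show ?thesis by simp
  qed
  then have "(\<Union>u'\<in>cox_class S M u. \<Union>v'\<in>cox_class S M v. cox_class S M (u' @ v')) =
      (\<Union>u'\<in>cox_class S M u. \<Union>v'\<in>cox_class S M v. cox_class S M (u @ v))"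
    by (intro SUP_cong refl)
  moreover have "u \<in> cox_class S M u" "v \<in> cox_class S M v"
    using assms by (auto simp: cox_class_def intro: cox_refl)
  then have "cox_class S M u \<noteq> {}" "cox_class S M v \<noteq> {}" by auto
  ultimately show ?thesis
    by (simp add: coxeter_group_def)
qed

lemma cox_eq_rev:
  assumes "\<And>s. s \<in> S \<Longrightarrow> M s s = 1" "u \<in> lists S"
  shows "cox_eq S M (rev u @ u) []"
  using assms(2)
proof (induction u)
  case Nil
  then show ?case by (simp add: cox_refl)
next
  case (Cons s u)
  have "cox_eq S M (rev u @ [s, s] @ u) (rev u @ u)"
    using cox_rel[of s S s "rev u" u M] Cons assms(1) by (auto simp: in_lists_conv_set)
  with Cons show ?case by (simp add: cox_trans[of S M _ "rev u @ u"])
qed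

lemma group_coxeter_group:
  assumes "\<And>s. s \<in> S \<Longrightarrow> M s s = 1"
  shows "group (coxeter_group S M)"
proof (rule groupI)
  show "\<one>\<^bsub>coxeter_group S M\<^esub> \<in> carrier (coxeter_group S M)"
    by (simp add: coxeter_group_def)
next
  fix g h assume "g \<in> carrier (coxeter_group S M)" "h \<in> carrier (coxeter_group S M)"
  then obtain u v where "u \<in> lists S" "v \<in> lists S" "g = cox_class S M u" "h = cox_class S M v"
    by (auto simp: coxeter_group_def)
  then show "g \<otimes>\<^bsub>coxeter_group S M\<^esub> h \<in> carrier (coxeter_group S M)"
    by (simp add: cox_class_mult) (simp add: coxeter_group_def)
next
  fix g h k assume "g \<in> carrier (coxeter_group S M)" "h \<in> carrier (coxeter_group S M)"
    "k \<in> carrier (coxeter_group S M)"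
  then obtain u v w where "u \<in> lists S" "v \<in> lists S" "w \<in> lists S"
    "g = cox_class S M u" "h = cox_class S M v" "k = cox_class S M w"
    by (auto simp: coxeter_group_def)
  then show "g \<otimes>\<^bsub>coxeter_group S M\<^esub> h \<otimes>\<^bsub>coxeter_group S M\<^esub> k =
      g \<otimes>\<^bsub>coxeter_group S M\<^esub> (h \<otimes>\<^bsub>coxeter_group S M\<^esub> k)"
    by (simp add: cox_class_mult)
next
  fix g assume "g \<in> carrier (coxeter_group S M)"
  then obtain u where u: "u \<in> lists S" "g = cox_class S M u"
    by (auto simp: coxeter_group_def)
  have one: "\<one>\<^bsub>coxeter_group S M\<^esub> = cox_class S M []"
    by (simp add: coxeter_group_def)
  show "\<one>\<^bsub>coxeter_group S M\<^esub> \<otimes>\<^bsub>coxeter_group S M\<^esub> g = g"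
    using u by (simp add: one cox_class_mult)
  have ru: "rev u \<in> lists S" using u by (auto simp: in_lists_conv_set)
  have "cox_class S M (rev u) \<otimes>\<^bsub>coxeter_group S M\<^esub> g = \<one>\<^bsub>coxeter_group S M\<^esub>"
    using u ru cox_class_eqI[OF cox_eq_rev[of S M u, OF assms]] by (simp add: one cox_class_mult)
  then show "\<exists>h\<in>carrier (coxeter_group S M). h \<otimes>\<^bsub>coxeter_group S M\<^esub> g = \<one>\<^bsub>coxeter_group S M\<^esub>"
    using ru by (auto simp: coxeter_group_def)
qed

lemma group_affine_group: "group (affine_group N)"
  unfolding affine_group_def by (rule group_coxeter_group) (simp add: affine_matrix_def)

lemma cox_eq_substitute:
  assumes "cox_eq S M u v"
    and "\<And>s. s \<in> S \<Longrightarrow> f s \<in> lists S'"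
    and "\<And>s t. s \<in> S \<Longrightarrow> t \<in> S \<Longrightarrow> cox_eq S' M' (concat (replicate (M s t) (f s @ f t))) []"
  shows "cox_eq S' M' (concat (map f u)) (concat (map f v))"
  using assms(1)
proof induction
  case (cox_rel s t u v)
  have "concat (map f (concat (replicate k [s, t]))) = concat (replicate k (f s @ f t))" for k
    by (induction k) auto
  moreover have "concat (map f u) \<in> lists S'" "concat (map f v) \<in> lists S'"
    using cox_rel assms(2) by (fastforce simp: in_lists_conv_set)+
  ultimately show ?case
    using cox_eq_context[OF assms(3)[of s t], of "concat (map f u)" "concat (map f v)"] cox_rel
    by simp
next
  case (cox_refl u)
  then show ?case using assms(2) by (intro cox_eq.cox_refl) (fastforce simp: in_lists_conv_set)
next
  case (cox_sym u v)
  show ?case by (rule cox_eq.cox_sym) (rule cox_sym.IH)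
next
  case (cox_trans u v w)
  show ?case by (rule cox_eq.cox_trans[OF cox_trans.IH])
qed

lemma word_class_Cons:
  assumes "s \<in> gens N" "u \<in> lists (gens N)"
  shows "word_class N (s # u) = word_class N [s] \<otimes>\<^bsub>affine_group N\<^esub> word_class N u"
  using cox_class_mult[of "[s]" "gens N" u "affine_matrix N"] assms
  by (simp add: word_class_def affine_group_def)

lemma word_class_closed: "u \<in> lists (gens N) \<Longrightarrow> word_class N u \<in> carrier (affine_group N)"
  by (simp add: word_class_def affine_group_def coxeter_group_def)

lemma word_class_Nil: "word_class N [] = \<one>\<^bsub>affine_group N\<^esub>"
  by (simp add: word_class_def affine_group_def coxeter_group_def)

lemma word_class_eq_iff:
  assumes "u \<in> lists (gens N)" "v \<in> lists (gens N)"
  shows "word_class N u = word_class N v \<longleftrightarrow> cox_eq (gens N) (affine_matrix N) u v"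
proof
  assume "word_class N u = word_class N v"
  then have "v \<in> word_class N u"
    using assms by (simp add: word_class_def cox_class_def cox_refl)
  then show "cox_eq (gens N) (affine_matrix N) u v"
    by (simp add: word_class_def cox_class_def)
qed (simp add: word_class_def cox_class_eqI)

lemma word_class_relation:
  assumes "s \<in> gens N" "t \<in> gens N" "u \<in> lists (gens N)"
  shows "word_class N (concat (replicate (affine_matrix N s t) [s, t]) @ u) = word_class N u"
  using cox_class_eqI[OF cox_rel[of s "gens N" t "[]" u "affine_matrix N"]] assms
  by (simp add: word_class_def)

lemma affine_group_relations:
  fixes N :: nat
  defines "y \<equiv> \<lambda>s. word_class N [s]" and "G \<equiv> affine_group N"
  assumes st: "s \<in> gens N" "t \<in> gens N" and z: "z \<in> carrier G"
  shows "y s \<otimes>\<^bsub>G\<^esub> (y s \<otimes>\<^bsub>G\<^esub> z) = z"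
    and "affine_matrix N s t = 2 \<Longrightarrow> y s \<otimes>\<^bsub>G\<^esub> (y t \<otimes>\<^bsub>G\<^esub> z) = y t \<otimes>\<^bsub>G\<^esub> (y s \<otimes>\<^bsub>G\<^esub> z)"
    and "affine_matrix N s t = 3 \<Longrightarrow>
      y s \<otimes>\<^bsub>G\<^esub> (y t \<otimes>\<^bsub>G\<^esub> (y s \<otimes>\<^bsub>G\<^esub> (y t \<otimes>\<^bsub>G\<^esub> (y s \<otimes>\<^bsub>G\<^esub> (y t \<otimes>\<^bsub>G\<^esub> z))))) = z"
    and "affine_matrix N s t = 3 \<Longrightarrow>
      y s \<otimes>\<^bsub>G\<^esub> (y t \<otimes>\<^bsub>G\<^esub> (y s \<otimes>\<^bsub>G\<^esub> z)) = y t \<otimes>\<^bsub>G\<^esub> (y s \<otimes>\<^bsub>G\<^esub> (y t \<otimes>\<^bsub>G\<^esub> z))"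
proof -
  interpret group G unfolding G_def by (rule group_affine_group)
  have y: "y s \<in> carrier G" "y t \<in> carrier G"
    using st by (auto simp: y_def G_def intro!: word_class_closed)
  have rel: "word_class N (concat (replicate (affine_matrix N p q) [p, q])) = \<one>\<^bsub>G\<^esub>"
    if "p \<in> gens N" "q \<in> gens N" for p q
    using word_class_relation[OF that, of "[]"] by (simp add: word_class_Nil G_def)
  have sq: "y p \<otimes>\<^bsub>G\<^esub> y p = \<one>\<^bsub>G\<^esub>" if "p \<in> gens N" for p
    using rel[OF that that] that
    by (simp add: affine_matrix_def y_def G_def word_class_Cons[of _ _ "[_]"])
  have inv2: "y p \<otimes>\<^bsub>G\<^esub> (y p \<otimes>\<^bsub>G\<^esub> v) = v" if "p \<in> gens N" "v \<in> carrier G" for p v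
  proof -
    have "y p \<in> carrier G" using that(1) by (auto simp: y_def G_def intro!: word_class_closed)
    then show ?thesis using sq[OF that(1)] that(2) by (simp flip: m_assoc)
  qed
  show "y s \<otimes>\<^bsub>G\<^esub> (y s \<otimes>\<^bsub>G\<^esub> z) = z" using inv2 st z by simp
  show "y s \<otimes>\<^bsub>G\<^esub> (y t \<otimes>\<^bsub>G\<^esub> z) = y t \<otimes>\<^bsub>G\<^esub> (y s \<otimes>\<^bsub>G\<^esub> z)" if "affine_matrix N s t = 2"
  proof -
    have "word_class N [s, t, s, t] = \<one>\<^bsub>G\<^esub>"
      using rel[OF st] that by (simp add: numeral_eq_Suc)
    then have "y s \<otimes>\<^bsub>G\<^esub> (y t \<otimes>\<^bsub>G\<^esub> (y s \<otimes>\<^bsub>G\<^esub> y t)) = \<one>\<^bsub>G\<^esub>"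
      using st by (simp add: y_def G_def word_class_Cons[of _ _ "_ # _"])
    then have a: "y s \<otimes>\<^bsub>G\<^esub> (y t \<otimes>\<^bsub>G\<^esub> (y s \<otimes>\<^bsub>G\<^esub> (y t \<otimes>\<^bsub>G\<^esub> z))) = z"
      using y z by (metis m_assoc m_closed l_one)
    have "y t \<otimes>\<^bsub>G\<^esub> (y s \<otimes>\<^bsub>G\<^esub> z) =
        y t \<otimes>\<^bsub>G\<^esub> (y s \<otimes>\<^bsub>G\<^esub> (y s \<otimes>\<^bsub>G\<^esub> (y t \<otimes>\<^bsub>G\<^esub> (y s \<otimes>\<^bsub>G\<^esub> (y t \<otimes>\<^bsub>G\<^esub> z)))))"
      by (simp add: a)
    also have "\<dots> = y s \<otimes>\<^bsub>G\<^esub> (y t \<otimes>\<^bsub>G\<^esub> z)" using st y z by (simp add: inv2)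
    finally show ?thesis by simp
  qed
  have b: "y s \<otimes>\<^bsub>G\<^esub> (y t \<otimes>\<^bsub>G\<^esub> (y s \<otimes>\<^bsub>G\<^esub> (y t \<otimes>\<^bsub>G\<^esub> (y s \<otimes>\<^bsub>G\<^esub> (y t \<otimes>\<^bsub>G\<^esub> v))))) = v"
    if "affine_matrix N s t = 3" "v \<in> carrier G" for v
  proof -
    have "word_class N [s, t, s, t, s, t] = \<one>\<^bsub>G\<^esub>"
      using rel[OF st] that by (simp add: numeral_eq_Suc)
    then have "y s \<otimes>\<^bsub>G\<^esub> (y t \<otimes>\<^bsub>G\<^esub> (y s \<otimes>\<^bsub>G\<^esub> (y t \<otimes>\<^bsub>G\<^esub> (y s \<otimes>\<^bsub>G\<^esub> y t)))) = \<one>\<^bsub>G\<^esub>"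
      using st by (simp add: y_def G_def word_class_Cons[of _ _ "_ # _"])
    then have "(y s \<otimes>\<^bsub>G\<^esub> (y t \<otimes>\<^bsub>G\<^esub> (y s \<otimes>\<^bsub>G\<^esub> (y t \<otimes>\<^bsub>G\<^esub> (y s \<otimes>\<^bsub>G\<^esub> y t))))) \<otimes>\<^bsub>G\<^esub> v = v"
      using that by simp
    then show ?thesis using y that by (simp add: m_assoc)
  qed
  show "affine_matrix N s t = 3 \<Longrightarrow>
      y s \<otimes>\<^bsub>G\<^esub> (y t \<otimes>\<^bsub>G\<^esub> (y s \<otimes>\<^bsub>G\<^esub> (y t \<otimes>\<^bsub>G\<^esub> (y s \<otimes>\<^bsub>G\<^esub> (y t \<otimes>\<^bsub>G\<^esub> z))))) = z"
    using b z by simp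
  show "y s \<otimes>\<^bsub>G\<^esub> (y t \<otimes>\<^bsub>G\<^esub> (y s \<otimes>\<^bsub>G\<^esub> z)) = y t \<otimes>\<^bsub>G\<^esub> (y s \<otimes>\<^bsub>G\<^esub> (y t \<otimes>\<^bsub>G\<^esub> z))"
    if "affine_matrix N s t = 3"
    using b[OF that, of "y t \<otimes>\<^bsub>G\<^esub> (y s \<otimes>\<^bsub>G\<^esub> (y t \<otimes>\<^bsub>G\<^esub> z))"] st y z by (simp add: inv2)
qed
lemma subst_word_lists:
  assumes "n \<ge> 3"
    and "u \<in> lists (gens (n - 1))"
  shows "subst_word n u \<in> lists (gens n)"
  using assms(2)
proof (induction u)
  case Nil
  then show ?case by (simp add: subst_word_def)
next
  case (Cons s u)
  have "s \<in> gens n"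
    using Cons(1) by (auto simp: gens_def)
  moreover have "Sig n \<in> gens n" "Aff \<in> gens n"
    using assms(1) by (simp_all add: gens_def)
  ultimately show ?case
    using Cons(3) by (simp add: subst_word_def)
qed

lemma subst_relation:
  assumes n: "n \<ge> 3" and st: "s \<in> gens (n - 1)" "t \<in> gens (n - 1)"
  shows "cox_eq (gens n) (affine_matrix n)
    (concat (replicate (affine_matrix (n - 1) s t) (subst_word n [s] @ subst_word n [t]))) []"
proof -
  define y where "y s = word_class n [s]" for s
  define G where "G = affine_group n"
  interpret group G unfolding G_def by (rule group_affine_group)
  have y: "y p \<in> carrier G" if "p \<in> gens n" for p
    unfolding y_def G_def using that by (intro word_class_closed) auto
  note R = affine_group_relations[of _ n, folded y_def G_def]
  have A: "Aff \<in> gens n" and S: "Sig k \<in> gens n \<longleftrightarrow> 1 \<le> k \<and> k \<le> n" for k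
    by (auto simp: gens_def)
  have Sn: "Sig n \<in> gens n" using n by (simp add: S)
  note cl = y[OF A] y[OF Sn]
  have wc: "word_class n (p # u) = y p \<otimes>\<^bsub>G\<^esub> word_class n u"
    if "p \<in> gens n" "u \<in> lists (gens n)" for p u
    unfolding y_def G_def by (rule word_class_Cons[OF that])
  have w1: "word_class n [] = \<one>\<^bsub>G\<^esub>" by (simp add: word_class_Nil G_def)
  have sub: "subst_word n [Sig k] = [Sig k]" "subst_word n [Aff] = [Sig n, Aff, Sig n]" for k
    by (auto simp: subst_word_def)
  have lists: "concat (replicate k (subst_word n [s] @ subst_word n [t])) \<in> lists (gens n)" for k
  proof -
    have "subst_word n [s] \<in> lists (gens n)" "subst_word n [t] \<in> lists (gens n)"
      using st by (intro subst_word_lists[OF n]; simp)+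
    then show ?thesis by (induction k) simp_all
  qed
  have sq: "y p \<otimes>\<^bsub>G\<^esub> (y p \<otimes>\<^bsub>G\<^esub> z) = z" if "p \<in> gens n" "z \<in> carrier G" for p z
    by (rule R(1)[OF that(1) that(1) that(2)])
  have sq1: "y p \<otimes>\<^bsub>G\<^esub> y p = \<one>\<^bsub>G\<^esub>" if "p \<in> gens n" for p
    using sq[OF that, of "\<one>\<^bsub>G\<^esub>"] y[OF that] by simp
  have mAn: "affine_matrix n Aff (Sig n) = 3" "affine_matrix n (Sig n) Aff = 3"
    by (auto simp: affine_matrix_def cycle_step_def)
  have nan: "y (Sig n) \<otimes>\<^bsub>G\<^esub> (y Aff \<otimes>\<^bsub>G\<^esub> (y (Sig n) \<otimes>\<^bsub>G\<^esub> z)) =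
      y Aff \<otimes>\<^bsub>G\<^esub> (y (Sig n) \<otimes>\<^bsub>G\<^esub> (y Aff \<otimes>\<^bsub>G\<^esub> z))" if "z \<in> carrier G" for z
    using R(4)[OF Sn A that mAn(2)] .
  have mixed: "word_class n (concat (replicate (affine_matrix (n - 1) (Sig k) Aff) [Sig k, Sig n, Aff, Sig n])) = \<one>\<^bsub>G\<^esub> \<and>
     word_class n (concat (replicate (affine_matrix (n - 1) (Sig k) Aff) [Sig n, Aff, Sig n, Sig k])) = \<one>\<^bsub>G\<^esub>"
    if k: "1 \<le> k" "k \<le> n - 1" for k
  proof -
    have Sk: "Sig k \<in> gens n" using k n by (simp add: S)
    note ck = y[OF Sk]
    consider "k = 1" | "k = n - 1" "k \<noteq> 1" | "1 < k" "k < n - 1" using k by linarith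
    then show ?thesis
    proof cases
      case 1
      have m: "affine_matrix (n - 1) (Sig k) Aff = 3" "affine_matrix n (Sig k) Aff = 3"
        "affine_matrix n Aff (Sig k) = 3" "affine_matrix n (Sig k) (Sig n) = 2"
        using 1 n by (auto simp: affine_matrix_def cycle_step_def)
      have com: "y (Sig k) \<otimes>\<^bsub>G\<^esub> (y (Sig n) \<otimes>\<^bsub>G\<^esub> z) = y (Sig n) \<otimes>\<^bsub>G\<^esub> (y (Sig k) \<otimes>\<^bsub>G\<^esub> z)"
        if "z \<in> carrier G" for z using R(2)[OF Sk Sn that m(4)] .
      have com1: "y (Sig k) \<otimes>\<^bsub>G\<^esub> y (Sig n) = y (Sig n) \<otimes>\<^bsub>G\<^esub> y (Sig k)"
        using com[OF one_closed] ck cl by simp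
      note b = R(3)[OF Sk A _ m(2)] R(3)[OF A Sk _ m(3)]
      show ?thesis
        using Sk Sn A ck cl m(1)
        by (intro conjI, simp add: numeral_eq_Suc wc w1 com com1 b sq sq1)
          (simp add: numeral_eq_Suc wc w1 com com1[symmetric] b sq sq1)
    next
      case 2
      have m: "affine_matrix (n - 1) (Sig k) Aff = 3" "affine_matrix n (Sig k) (Sig n) = 3"
        "affine_matrix n (Sig n) (Sig k) = 3" "affine_matrix n Aff (Sig k) = 2"
        using 2 n by (auto simp: affine_matrix_def cycle_step_def)
      have com: "y Aff \<otimes>\<^bsub>G\<^esub> (y (Sig k) \<otimes>\<^bsub>G\<^esub> z) = y (Sig k) \<otimes>\<^bsub>G\<^esub> (y Aff \<otimes>\<^bsub>G\<^esub> z)"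
        if "z \<in> carrier G" for z using R(2)[OF A Sk that m(4)] .
      have com1: "y Aff \<otimes>\<^bsub>G\<^esub> y (Sig k) = y (Sig k) \<otimes>\<^bsub>G\<^esub> y Aff"
        using com[OF one_closed] ck cl by simp
      have nan1: "y (Sig n) \<otimes>\<^bsub>G\<^esub> (y Aff \<otimes>\<^bsub>G\<^esub> y (Sig n)) = y Aff \<otimes>\<^bsub>G\<^esub> (y (Sig n) \<otimes>\<^bsub>G\<^esub> y Aff)"
        using nan[OF one_closed] cl by simp
      note b = R(3)[OF Sk Sn _ m(2)] R(3)[OF Sn Sk _ m(3)]
      show ?thesis
        using Sk Sn A ck cl m(1)
        by (intro conjI, simp add: numeral_eq_Suc wc w1 nan nan1, simp add: com[symmetric] com1[symmetric] b sq sq1)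
          (simp add: numeral_eq_Suc wc w1 nan nan1, simp add: com com1 b sq sq1)
    next
      case 3
      have m: "affine_matrix (n - 1) (Sig k) Aff = 2" "affine_matrix n (Sig k) (Sig n) = 2"
        "affine_matrix n (Sig k) Aff = 2"
        using 3 n by (auto simp: affine_matrix_def cycle_step_def)
      have com2: "y (Sig k) \<otimes>\<^bsub>G\<^esub> (y (Sig n) \<otimes>\<^bsub>G\<^esub> z) = y (Sig n) \<otimes>\<^bsub>G\<^esub> (y (Sig k) \<otimes>\<^bsub>G\<^esub> z)"
        if "z \<in> carrier G" for z using R(2)[OF Sk Sn that m(2)] .
      have com2': "y (Sig k) \<otimes>\<^bsub>G\<^esub> y (Sig n) = y (Sig n) \<otimes>\<^bsub>G\<^esub> y (Sig k)"
        using com2[OF one_closed] ck cl by simp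
      have com3: "y (Sig k) \<otimes>\<^bsub>G\<^esub> (y Aff \<otimes>\<^bsub>G\<^esub> z) = y Aff \<otimes>\<^bsub>G\<^esub> (y (Sig k) \<otimes>\<^bsub>G\<^esub> z)"
        if "z \<in> carrier G" for z using R(2)[OF Sk A that m(3)] .
      have com3': "y (Sig k) \<otimes>\<^bsub>G\<^esub> y Aff = y Aff \<otimes>\<^bsub>G\<^esub> y (Sig k)"
        using com3[OF one_closed] ck cl by simp
      show ?thesis
        using Sk Sn A ck cl m(1)
        by (simp add: numeral_eq_Suc wc w1 com2 com2' com3 com3' sq sq1)
    qed
  qed
  have msym: "affine_matrix (n - 1) Aff p = affine_matrix (n - 1) p Aff" for p
    by (auto simp: affine_matrix_def)
  have "word_class n (concat (replicate (affine_matrix (n - 1) s t) (subst_word n [s] @ subst_word n [t]))) = \<one>\<^bsub>G\<^esub>"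
  proof (cases s)
    case (Sig k)
    then have k: "1 \<le> k" "k \<le> n - 1" using st by (auto simp: gens_def)
    show ?thesis
    proof (cases t)
      case (Sig l)
      then have l: "1 \<le> l" "l \<le> n - 1" using st by (auto simp: gens_def)
      have "affine_matrix (n - 1) s t = affine_matrix n s t"
        using k l \<open>s = Sig k\<close> Sig by (auto simp: affine_matrix_def cycle_step_def)
      then show ?thesis
        using word_class_relation[of s n t "[]"] k l \<open>s = Sig k\<close> Sig
        by (simp add: sub w1 S)
    next
      case Aff
      then show ?thesis using mixed[OF k] Sig by (simp add: sub)
    qed
  next
    case Aff
    show ?thesis
    proof (cases t)
      case (Sig l)
      then have "1 \<le> l" "l \<le> n - 1" using st by (auto simp: gens_def)
      then show ?thesis
        using mixed[of l] Sig Aff by (simp only: sub msym[of "Sig l"]) simp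
    next
      case t: Aff
      show ?thesis using Aff t A Sn cl
        by (simp add: sub affine_matrix_def wc w1 sq sq1)
    qed
  qed
  then show ?thesis
    using word_class_eq_iff[OF lists, of "[]"] by (simp add: w1)
qed

lemma subst_word_append: "subst_word n (u @ v) = subst_word n u @ subst_word n v"
  by (simp add: subst_word_def)

lemma affine_embedding_word_class:
  assumes n: "n \<ge> 3" and u: "u \<in> lists (gens (n - 1))"
  shows "affine_embedding n (word_class (n - 1) u) = word_class n (subst_word n u)"
proof -
  have sw: "subst_word n v = concat (map (\<lambda>s. subst_word n [s]) v)" for v
    by (simp add: subst_word_def)
  have "word_class n (subst_word n v) = word_class n (subst_word n u)"
    if "v \<in> word_class (n - 1) u" for v
  proof -
    have "cox_eq (gens (n - 1)) (affine_matrix (n - 1)) u v"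
      using that by (simp add: word_class_def cox_class_def)
    then have "cox_eq (gens n) (affine_matrix n) (subst_word n u) (subst_word n v)"
      unfolding sw[of u] sw[of v]
      by (rule cox_eq_substitute) (use subst_word_lists[OF n] subst_relation[OF n] in auto)
    then show ?thesis by (simp add: word_class_def cox_class_eqI)
  qed
  then have "affine_embedding n (word_class (n - 1) u) =
      (\<Union>v\<in>word_class (n - 1) u. word_class n (subst_word n u))"
    unfolding affine_embedding_def by (intro SUP_cong refl)
  moreover have "u \<in> word_class (n - 1) u"
    using u by (simp add: word_class_def cox_class_def cox_refl)
  then have "word_class (n - 1) u \<noteq> {}" by auto
  ultimately show ?thesis by simp
qed

lemma affine_embedding_hom:
  assumes n: "n \<ge> 3"
  shows "affine_embedding n \<in> hom (affine_group (n - 1)) (affine_group n)"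
proof (rule homI)
  have carrier: "\<exists>u\<in>lists (gens (n - 1)). g = word_class (n - 1) u"
    if "g \<in> carrier (affine_group (n - 1))" for g
    using that by (auto simp: affine_group_def coxeter_group_def word_class_def)
  show "affine_embedding n g \<in> carrier (affine_group n)" if g: "g \<in> carrier (affine_group (n - 1))" for g
  proof -
    obtain u where u: "u \<in> lists (gens (n - 1))" "g = word_class (n - 1) u"
      using carrier[OF g] by blast
    show ?thesis
      unfolding u(2) affine_embedding_word_class[OF n u(1)]
      by (rule word_class_closed[OF subst_word_lists[OF n u(1)]])
  qed
  show "affine_embedding n (g \<otimes>\<^bsub>affine_group (n - 1)\<^esub> h) = affine_embedding n g \<otimes>\<^bsub>affine_group n\<^esub> affine_embedding n h"
    if gh: "g \<in> carrier (affine_group (n - 1))" "h \<in> carrier (affine_group (n - 1))" for g h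
  proof -
    obtain u v where u: "u \<in> lists (gens (n - 1))" "g = word_class (n - 1) u"
      and v: "v \<in> lists (gens (n - 1))" "h = word_class (n - 1) v"
      using carrier[OF gh(1)] carrier[OF gh(2)] by blast
    have mult: "word_class N p \<otimes>\<^bsub>affine_group N\<^esub> word_class N q = word_class N (p @ q)"
      if "p \<in> lists (gens N)" "q \<in> lists (gens N)" for N p q
      using that by (simp add: word_class_def affine_group_def cox_class_mult)
    have uv: "u @ v \<in> lists (gens (n - 1))" using u v by simp
    show ?thesis
      unfolding u(2) v(2) mult[OF u(1) v(1)] affine_embedding_word_class[OF n u(1)]
        affine_embedding_word_class[OF n v(1)] affine_embedding_word_class[OF n uv]
        mult[OF subst_word_lists[OF n u(1)] subst_word_lists[OF n v(1)]]
      by (simp add: subst_word_append)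
  qed
qed

lemma affine_embedding_Sig:
  "n \<ge> 3 \<Longrightarrow> 1 \<le> i \<Longrightarrow> i \<le> n - 1 \<Longrightarrow> affine_embedding n (word_class (n - 1) [Sig i]) = word_class n [Sig i]"
  by (subst affine_embedding_word_class) (auto simp: gens_def subst_word_def)

lemma affine_embedding_Aff:
  "n \<ge> 3 \<Longrightarrow> affine_embedding n (word_class (n - 1) [Aff]) = word_class n [Sig n, Aff, Sig n]"
  by (subst affine_embedding_word_class) (auto simp: gens_def subst_word_def)

end

theory Submission
  imports Defs
begin

text \<open>
  The affine group of rank parameter \<open>N\<close> acts on the right on windows: an affine permutation \<open>w\<close> is the
  list \<open>w(1), \<dots>, w(N + 1)\<close>, \<open>\<sigma>\<^sub>i\<close> swaps two neighbours, and \<open>a\<^sub>N\<^sub>+\<^sub>1\<close> swaps the first and the last entry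
  while lowering the one and raising the other by \<open>N + 1\<close>. Every letter changes the number of affine
  inversions by one, so a word all of whose letters are ascents is reduced; and every \<open>a\<^sub>N\<^sub>+\<^sub>1\<close> changes
  half the norm of the translation part by at most one, which bounds the affine length from below.

  Applied to an increasing window, a block \<open>h\<^sub>N(r, i) a\<^sub>N\<^sub>+\<^sub>1\<close> lowers the entry \<open>p\<close> in position \<open>r\<close> and raises
  the \<open>(i + 1)\<close>-st of the remaining entries, \<open>q\<close>. The pairwise inequalities make \<open>p\<close> decrease and \<open>q\<close>
  increase from block to block, so all windows between blocks are increasing, all letters are ascents,
  and every block counts for the translation part.

  On windows, \<open>R\<^sub>n\<close> replaces an entry \<open>r + n d\<close> (\<open>1 \<le> r \<le> n\<close>) by \<open>r + (n + 1) d\<close> and appends \<open>n + 1\<close>. Sorting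
  \<open>n + 1\<close> into the increasing window shifts \<open>i\<^sub>k\<close> by one once a block raises an entry that was raised
  before, which happens for \<open>k > s\<close>; the factor \<open>\<lfloor>t, n\<rfloor>\<close> then moves \<open>n + 1\<close> to the end. Braid
  equivalence of the two reduced words follows from Matsumoto's theorem.
\<close>

section \<open>Affine permutations\<close>

text \<open>Lists are indexed from 0, so \<open>\<sigma>\<^sub>i\<close> swaps the entries \<open>i - 1\<close> and \<open>i\<close>.\<close>

definition act :: "nat \<Rightarrow> gen \<Rightarrow> int list \<Rightarrow> int list" where
  "act N s c = (case s of
     Sig i \<Rightarrow> c[i - 1 := c ! i, i := c ! (i - 1)]
   | Aff \<Rightarrow> c[0 := c ! N - int (Suc N), N := c ! 0 + int (Suc N)])"

definition run :: "nat \<Rightarrow> gen list \<Rightarrow> int list \<Rightarrow> int list" where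
  "run N u c = fold (act N) u c"

text \<open>For the periodic extension \<open>w(k + N + 1) = w(k) + N + 1\<close>, the
  \<open>Aff\<close> case compares the values at positions N + 1 and N + 2, an ordinary ascent one
  place beyond the window.\<close>

definition ascent :: "nat \<Rightarrow> gen \<Rightarrow> int list \<Rightarrow> bool" where
  "ascent N s c \<longleftrightarrow> (case s of Sig i \<Rightarrow> c ! (i - 1) < c ! i | Aff \<Rightarrow> c ! N < c ! 0 + int (Suc N))"

text \<open>Distinct residues make the periodic extension a bijection of the integers, and the fixed
  sum normalizes it against shifts; together they characterize affine permutations.\<close>

definition window :: "nat \<Rightarrow> int list \<Rightarrow> bool" where
  "window N c \<longleftrightarrow> length c = Suc N \<and> distinct (map (\<lambda>z. z mod int (Suc N)) c) \<and>
     sum_list c = (\<Sum>k=1..int (Suc N). k)"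

text \<open>Shi's formula for the length of an affine permutation.\<close>

definition inversions :: "nat \<Rightarrow> int list \<Rightarrow> int" where
  "inversions N c = (\<Sum>(a, b)\<in>{(a, b). a < b \<and> b \<le> N}. \<bar>(c ! b - c ! a) div int (Suc N)\<bar>)"

definition id_window :: "nat \<Rightarrow> int list" where
  "id_window N = [1..int (Suc N)]"

lemma run_simps [simp]:
  "run N [] c = c" "run N (s # u) c = run N u (act N s c)" "run N (u @ v) c = run N v (run N u c)"
  by (simp_all add: run_def)

lemma length_act [simp]: "length (act N s c) = length c"
  by (simp add: act_def split: gen.split)

lemma length_run [simp]: "length (run N u c) = length c"
  by (induction u arbitrary: c) simp_all

lemma gens_cases:
  assumes "s \<in> gens N"
  obtains (Sig) i where "s = Sig i" "1 \<le> i" "i \<le> N" | (Aff) "s = Aff"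
  using assms by (auto simp: gens_def)

section \<open>Coxeter relations for the action on windows\<close>

lemma act_act:
  assumes "N \<ge> 1" "s \<in> gens N" "length c = Suc N"
  shows "act N s (act N s c) = c"
  using assms(2)
proof (cases rule: gens_cases)
  case (Sig i)
  then show ?thesis using assms
    by (intro nth_equalityI) (auto simp: act_def nth_list_update)
next
  case Aff
  then show ?thesis using assms
    by (intro nth_equalityI) (auto simp: act_def nth_list_update)
qed

lemma act_commute:
  assumes "s \<in> gens N" "t \<in> gens N" "affine_matrix N s t = 2" "length c = Suc N"
  shows "act N s (act N t c) = act N t (act N s c)"
  using assms(1)
proof (cases rule: gens_cases)
  case s: (Sig i)
  show ?thesis using assms(2)
  proof (cases rule: gens_cases)
    case (Sig k)
    then have "i \<noteq> k" "i \<noteq> k - 1" "k \<noteq> i - 1" "i - 1 \<noteq> k - 1"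
      using s assms(3) by (auto simp: affine_matrix_def cycle_step_def split: if_splits)
    then show ?thesis using s Sig assms(4)
      by (simp add: act_def list_update_swap)
  next
    case Aff
    then have "i \<noteq> 1" "i \<noteq> N" using s assms(3)
      by (auto simp: affine_matrix_def cycle_step_def split: if_splits)
    then have "i \<noteq> 0" "i - 1 \<noteq> 0" "i \<noteq> N" "i - 1 \<noteq> N" using s by auto
    then show ?thesis using s Aff assms(4)
      by (simp add: act_def list_update_swap)
  qed
next
  case s: Aff
  show ?thesis using assms(2)
  proof (cases rule: gens_cases)
    case (Sig i)
    then have "i \<noteq> 1" "i \<noteq> N" using s assms(3)
      by (auto simp: affine_matrix_def cycle_step_def split: if_splits)
    then have "i \<noteq> 0" "i - 1 \<noteq> 0" "i \<noteq> N" "i - 1 \<noteq> N" using Sig by auto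
    then show ?thesis using s Sig assms(4)
      by (simp add: act_def list_update_swap)
  qed (simp add: s)
qed

lemma cycle_step_cases:
  assumes "cycle_step N s t"
  obtains (Sig_Sig) i where "s = Sig (Suc i)" "t = Sig (Suc (Suc i))" "Suc i < N"
    | (Sig_Aff) "s = Sig N" "t = Aff" | (Aff_Sig) "s = Aff" "t = Sig 1"
proof -
  consider i where "1 \<le> i" "i < N" "s = Sig i" "t = Sig (i + 1)"
    | "s = Sig N \<and> t = Aff" | "s = Aff \<and> t = Sig 1"
    using assms by (auto simp: cycle_step_def)
  then show ?thesis
  proof cases
    case (1 i)
    then show ?thesis using Sig_Sig[of "i - 1"] by auto
  qed (use that in auto)
qed

lemma act_braid_step:
  assumes "N \<ge> 2" "cycle_step N s t" "length c = Suc N"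
  shows "act N s (act N t (act N s c)) = act N t (act N s (act N t c))"
  using assms(2)
proof (cases rule: cycle_step_cases)
  case (Sig_Sig i)
  then show ?thesis using assms
    by (intro nth_equalityI) (simp_all add: act_def nth_list_update)
next
  case Sig_Aff
  then show ?thesis using assms
    by (intro nth_equalityI) (simp_all add: act_def nth_list_update)
next
  case Aff_Sig
  then show ?thesis using assms
    by (intro nth_equalityI) (simp_all add: act_def nth_list_update)
qed

lemma affine_matrix_3_cases:
  assumes "affine_matrix N s t = 3"
  shows "cycle_step N s t \<or> cycle_step N t s"
  using assms by (auto simp: affine_matrix_def split: if_splits)

lemma act_braid:
  assumes "N \<ge> 2" "affine_matrix N s t = 3" "length c = Suc N"
  shows "act N s (act N t (act N s c)) = act N t (act N s (act N t c))"
  using affine_matrix_3_cases[OF assms(2)] act_braid_step assms by metis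

lemma affine_matrix_cases:
  obtains "s = t" "affine_matrix N s t = 1" | "s \<noteq> t" "affine_matrix N s t = 2"
    | "s \<noteq> t" "affine_matrix N s t = 3"
  by (cases "s = t"; cases "cycle_step N s t \<or> cycle_step N t s") (auto simp: affine_matrix_def)

lemma run_relation:
  assumes N: "N \<ge> 2" and st: "s \<in> gens N" "t \<in> gens N" and c: "length c = Suc N"
  shows "run N (concat (replicate (affine_matrix N s t) [s, t])) c = c"
proof -
  have aa: "act N p (act N p d) = d" if "p \<in> gens N" "length d = Suc N" for p d
    using act_act that N by simp
  show ?thesis
  proof (cases rule: affine_matrix_cases[of s t N])
    case 1
    then show ?thesis using aa st c by simp
  next
    case 2
    then show ?thesis using aa st c act_commute[OF st 2(2)] by (simp add: numeral_eq_Suc)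
  next
    case 3
    then show ?thesis
      using aa st c act_braid[OF N 3(2), of "act N t (act N s (act N t c))"]
      by (simp add: numeral_eq_Suc act_braid[OF N 3(2) c])
  qed
qed

text \<open>By the relations, the window reached from \<open>id_window N\<close> depends only on the
  group element, so a statistic of this window constrains all expressions of the element at
  once.\<close>

lemma cox_eq_run:
  assumes "cox_eq (gens N) (affine_matrix N) u v" "N \<ge> 2" "length c = Suc N"
  shows "run N u c = run N v c"
  using assms(1,3)
proof (induction arbitrary: c)
  case (cox_rel s t u v)
  then show ?case using run_relation[OF assms(2), of s t "run N u c"] by simp
qed auto

section \<open>Change of the inversion number under a letter\<close>

lemma sum_bij_except_one:
  fixes g g' :: "'b \<Rightarrow> int"
  assumes "finite P" "e \<in> P" "bij_betw \<phi> (P - {e}) (P - {e})" "\<And>z. z \<in> P - {e} \<Longrightarrow> g' z = g (\<phi> z)"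
  shows "sum g' P = sum g P + (g' e - g e)"
proof -
  have "sum g' (P - {e}) = sum g (P - {e})"
    using sum.reindex_bij_betw[OF assms(3), of g] assms(4) by simp
  then show ?thesis using sum.remove[OF assms(1,2), of g] sum.remove[OF assms(1,2), of g'] by simp
qed

lemma div_neg:
  fixes d M :: int
  assumes "M > 0" "d mod M \<noteq> 0"
  shows "(- d) div M = - (d div M) - 1"
  using assms by (simp add: zdiv_zminus1_eq_if)

lemma window_diff:
  assumes "window N c" "a \<le> N" "b \<le> N" "a \<noteq> b"
  shows "(c ! b - c ! a) mod int (Suc N) \<noteq> 0"
proof
  assume "(c ! b - c ! a) mod int (Suc N) = 0"
  then have "c ! b mod int (Suc N) = c ! a mod int (Suc N)"
    by (metis mod_eq_dvd_iff dvd_eq_mod_eq_0)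
  then show False
    using assms nth_eq_iff_index_eq[of "map (\<lambda>z. z mod int (Suc N)) c" a b]
    by (simp add: window_def less_Suc_eq_le)
qed

lemma window_neq:
  assumes "window N c" "a \<le> N" "b \<le> N" "a \<noteq> b"
  shows "c ! a \<noteq> c ! b"
  using window_diff[OF assms] by auto

lemma sum_list_list_update:
  fixes c :: "'b::ab_group_add list"
  shows "k < length c \<Longrightarrow> sum_list (c[k := z]) = sum_list c + z - c ! k"
  by (induction c arbitrary: k) (auto split: nat.split)

lemma window_act:
  assumes "N \<ge> 1" "window N c" "s \<in> gens N"
  shows "window N (act N s c)"
proof -
  define r where "r z = z mod int (Suc N)" for z
  have c: "length c = Suc N" "distinct (map r c)" "sum_list c = (\<Sum>k=1..int (Suc N). k)"
    using assms(2) by (simp_all add: window_def r_def[abs_def])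
  have "distinct (map r (act N s c)) \<and> sum_list (act N s c) = sum_list c"
    using assms(3)
  proof (cases rule: gens_cases)
    case (Sig i)
    have "map r (act N s c) = (map r c)[i - 1 := map r c ! i, i := map r c ! (i - 1)]"
      using Sig c(1) by (simp add: act_def map_update)
    then have "distinct (map r (act N s c))"
      using distinct_swap[of "i - 1" "map r c" i] Sig c by simp
    then show ?thesis
      using Sig c(1) by (auto simp: sum_list_list_update act_def nth_list_update)
  next
    case Aff
    have "map r (act N s c) = (map r c)[0 := map r c ! N, N := map r c ! 0]"
      using Aff c(1) by (simp add: act_def map_update r_def del: of_nat_Suc)
    then have "distinct (map r (act N s c))"
      using distinct_swap[of 0 "map r c" N] c by simp
    then show ?thesis
      using Aff c(1) assms(1) by (auto simp: sum_list_list_update act_def nth_list_update)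
  qed
  then show ?thesis using c by (simp add: window_def r_def[abs_def])
qed

lemma finite_pairs: "finite {(a, b). a < b \<and> b \<le> (N::nat)}"
  by (rule finite_subset[of _ "{..N} \<times> {..N}"]) auto

text \<open>A letter permutes the terms of the sum among all pairs of positions but one. If k is the
  quotient at the remaining pair, it becomes -k - 1 for \<open>Sig i\<close> and 1 - k for
  \<open>Aff\<close>, so its absolute value changes by one, upwards exactly at an ascent.\<close>

lemma inversions_act:
  assumes N: "N \<ge> 1" and c: "window N c" and s: "s \<in> gens N"
  shows "inversions N (act N s c) = inversions N c + (if ascent N s c then 1 else -1)"
proof -
  define M where "M = int (Suc N)"
  define P where "P = {(a, b). a < b \<and> b \<le> N}"
  define G where "G c = (\<lambda>(a, b). \<bar>(c ! b - c ! a) div M\<bar>)" for c :: "int list"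
  have M: "M > 0" by (simp add: M_def)
  have fin: "finite P" unfolding P_def by (rule finite_pairs)
  have inv: "inversions N d = sum (G d) P" for d
    by (simp add: inversions_def P_def G_def M_def case_prod_unfold)
  have len: "length c = Suc N" using c by (simp add: window_def)
  have neg: "(c ! a - c ! b) div M = - ((c ! b - c ! a) div M) - 1" if "a \<le> N" "b \<le> N" "a \<noteq> b" for a b
    using div_neg[of M "c ! b - c ! a"] window_diff[OF c that] M by (simp add: M_def)
  have sgn: "(c ! b - c ! a) div M \<ge> 0 \<longleftrightarrow> c ! a < c ! b" if "a \<le> N" "b \<le> N" "a \<noteq> b" for a b
    using pos_imp_zdiv_nonneg_iff[OF M] window_neq[OF c that] by auto
  show ?thesis using s
  proof (cases rule: gens_cases)
    case (Sig i)
    define \<tau> where "\<tau> a = (if a = i then i - 1 else if a = i - 1 then i else a)" for a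
    have \<tau>\<tau>: "\<tau> (\<tau> a) = a" for a by (auto simp: \<tau>_def)
    have nth: "act N s c ! a = c ! \<tau> a" if "a \<le> N" for a
      using that Sig len by (auto simp: act_def nth_list_update \<tau>_def)
    have mem: "map_prod \<tau> \<tau> z \<in> P - {(i - 1, i)}" if "z \<in> P - {(i - 1, i)}" for z
      using that Sig by (auto simp: P_def \<tau>_def split: if_splits)
    have bij: "bij_betw (map_prod \<tau> \<tau>) (P - {(i - 1, i)}) (P - {(i - 1, i)})"
      by (rule bij_betwI[where g = "map_prod \<tau> \<tau>"]) (use mem in \<open>auto simp: \<tau>\<tau>\<close>)
    have "sum (G (act N s c)) P = sum (G c) P + (G (act N s c) (i - 1, i) - G c (i - 1, i))"
    proof (rule sum_bij_except_one[OF fin _ bij])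
      show "(i - 1, i) \<in> P" using Sig by (auto simp: P_def)
      show "G (act N s c) z = G c (map_prod \<tau> \<tau> z)" if "z \<in> P - {(i - 1, i)}" for z
        using that by (auto simp: G_def P_def nth)
    qed
    moreover have "G (act N s c) (i - 1, i) = \<bar>(c ! (i - 1) - c ! i) div M\<bar>"
      using Sig nth[of i] nth[of "i - 1"] by (simp add: G_def \<tau>_def)
    moreover have "(c ! (i - 1) - c ! i) div M = - ((c ! i - c ! (i - 1)) div M) - 1"
      using Sig neg[of "i - 1" i] by simp
    moreover have "(c ! i - c ! (i - 1)) div M \<ge> 0 \<longleftrightarrow> ascent N s c"
      using Sig sgn[of "i - 1" i] by (simp add: ascent_def)
    ultimately show ?thesis by (auto simp: inv G_def abs_if)
  next
    case Aff
    \<comment> \<open>The pair \<open>(0, b)\<close> takes over the term of \<open>(b, N)\<close>,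
      and \<open>(a, N)\<close> that of \<open>(0, a)\<close>. Both reverse a difference, and the -1
      caused by rounding is cancelled by the shift of one entry by \<open>M\<close>.\<close>
    define \<tau> where "\<tau> = (\<lambda>(a, b). if a = 0 then (b, N) else if b = N then (0, a) else (a, b))"
    have nth: "act N s c ! a = (if a = 0 then c ! N - M else if a = N then c ! 0 + M else c ! a)" if "a \<le> N" for a
      using that Aff len N by (auto simp: act_def nth_list_update M_def)
    have mem: "\<tau> z \<in> P - {(0, N)}" if "z \<in> P - {(0, N)}" for z
      using that Aff by (auto simp: P_def \<tau>_def split: if_splits)
    have bij: "bij_betw \<tau> (P - {(0, N)}) (P - {(0, N)})"
      by (rule bij_betwI[where g = \<tau>]) (use mem in \<open>auto simp: \<tau>_def P_def split: if_splits\<close>)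
    have shift: "(y - (x - M)) div M = (y - x) div M + 1" "(x + M - y) div M = (x - y) div M + 1" for x y
    proof -
      have "(y - (x - M)) div M = ((y - x) + M) div M" "(x + M - y) div M = ((x - y) + M) div M"
        by (simp_all add: algebra_simps)
      then show "(y - (x - M)) div M = (y - x) div M + 1" "(x + M - y) div M = (x - y) div M + 1"
        using M by (simp_all only: div_add_self2[OF less_imp_neq[THEN not_sym]])
    qed
    have "sum (G (act N s c)) P = sum (G c) P + (G (act N s c) (0, N) - G c (0, N))"
    proof (rule sum_bij_except_one[OF fin _ bij])
      show "(0, N) \<in> P" using N by (auto simp: P_def)
      show "G (act N s c) z = G c (\<tau> z)" if zP: "z \<in> P - {(0, N)}" for z
      proof -
        obtain a b where z: "z = (a, b)" "a < b" "b \<le> N" "\<not> (a = 0 \<and> b = N)"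
          using zP by (cases z) (auto simp: P_def)
        then show ?thesis
          using neg[of N b] neg[of a 0]
          by (auto simp: G_def nth \<tau>_def shift)
      qed
    qed
    moreover have "G (act N s c) (0, N) = \<bar>1 - (c ! N - c ! 0) div M\<bar>"
      using N nth[of 0] nth[of N] neg[of 0 N] shift(1)[of "c ! 0 + M" "c ! N"] shift(2)[of "c ! 0" "c ! N"]
      by (simp add: G_def)
    moreover have "(c ! N - c ! 0) div M \<le> 0 \<longleftrightarrow> ascent N s c"
    proof -
      have "(c ! N - c ! 0) div M \<ge> 1 \<longleftrightarrow> c ! N - c ! 0 \<ge> M"
        using pos_imp_zdiv_pos_iff[OF M, of "c ! N - c ! 0"] by linarith
      then show ?thesis using Aff by (auto simp: M_def ascent_def)
    qed
    ultimately show ?thesis by (auto simp: inv G_def abs_if)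
  qed
qed

section \<open>Ascending words\<close>

fun ascending :: "nat \<Rightarrow> gen list \<Rightarrow> int list \<Rightarrow> bool" where
  "ascending N [] c = True"
| "ascending N (s # u) c = (ascent N s c \<and> ascending N u (act N s c))"

lemma ascending_append:
  "ascending N (u @ v) c \<longleftrightarrow> ascending N u c \<and> ascending N v (run N u c)"
  by (induction u arbitrary: c) auto

lemma window_run:
  assumes "N \<ge> 1" "window N c" "u \<in> lists (gens N)"
  shows "window N (run N u c)"
  using assms(3,2) by (induction u arbitrary: c) (auto intro: window_act[OF assms(1)])

lemma inversions_run_le:
  assumes "N \<ge> 1" "window N c" "u \<in> lists (gens N)"
  shows "inversions N (run N u c) \<le> inversions N c + int (length u)"
  using assms(3,2)
proof (induction u arbitrary: c)
  case (Cons s u)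
  have "inversions N (run N u (act N s c)) \<le> inversions N (act N s c) + int (length u)"
    using Cons window_act[OF assms(1)] by auto
  then show ?case
    using Cons inversions_act[OF assms(1), of c s] by (auto split: if_splits)
qed simp

text \<open>Each letter contributes 1 or -1, so the maximum is reached only without descents. The
  right side sees only the length and the final window, which transfers ascent between words of
  equal length that end in the same window.\<close>

lemma ascending_iff_inversions:
  assumes "N \<ge> 1" "window N c" "u \<in> lists (gens N)"
  shows "ascending N u c \<longleftrightarrow> inversions N (run N u c) = inversions N c + int (length u)"
  using assms(3,2)
proof (induction u arbitrary: c)
  case (Cons s u)
  have w: "window N (act N s c)" using Cons window_act[OF assms(1)] by auto
  have "inversions N (run N u (act N s c)) \<le> inversions N (act N s c) + int (length u)"
    by (rule inversions_run_le[OF assms(1) w]) (use Cons in auto)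
  then show ?case
    using Cons.IH[OF w] Cons inversions_act[OF assms(1), of c s] by (auto split: if_splits)
qed simp

lemma ascent_act:
  assumes "N \<ge> 1" "window N c" "s \<in> gens N"
  shows "ascent N s (act N s c) \<longleftrightarrow> \<not> ascent N s c"
proof -
  have "length c = Suc N" using assms(2) by (simp add: window_def)
  then have "inversions N c = inversions N (act N s c) + (if ascent N s (act N s c) then 1 else -1)"
    using inversions_act[OF assms(1) window_act[OF assms] assms(3)] act_act[OF assms(1,3)] by simp
  then show ?thesis
    using inversions_act[OF assms] by (auto split: if_splits)
qed

lemma window_id: "window N (id_window N)"
proof -
  have "map (\<lambda>z. z mod int (Suc N)) (id_window N) = [1..int N] @ [0]"
  proof -
    have "id_window N = [1..int N] @ [int (Suc N)]"
      unfolding id_window_def by (subst upto_rec2) auto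
    moreover have "map (\<lambda>z. z mod int (Suc N)) [1..int N] = [1..int N]"
      by (intro map_idI) auto
    ultimately show ?thesis by simp
  qed
  moreover have "length (id_window N) = Suc N" by (simp add: id_window_def)
  moreover have "sum_list (id_window N) = (\<Sum>k=1..int (Suc N). k)"
    unfolding id_window_def
    using interv_sum_list_conv_sum_set_int[of "\<lambda>k. k" 1 "int (Suc N)"] by simp
  ultimately show ?thesis by (simp add: window_def)
qed

lemma length_id_window [simp]: "length (id_window N) = Suc N"
  by (simp add: id_window_def)

lemma nth_id_window: "a \<le> N \<Longrightarrow> id_window N ! a = 1 + int a"
  by (simp add: id_window_def)

lemma inversions_id: "inversions N (id_window N) = 0"
  unfolding inversions_def by (intro sum.neutral) (auto simp: nth_id_window)

lemma inversions_nonneg: "inversions N c \<ge> 0"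
  unfolding inversions_def by (intro sum_nonneg) auto

lemma no_descent_increasing:
  assumes "\<And>s. s \<in> gens N \<Longrightarrow> ascent N s c" "a \<le> b" "b \<le> N"
  shows "c ! a + int (b - a) \<le> c ! b"
  using assms(2,3)
proof (induction b rule: dec_induct)
  case (step b)
  have "ascent N (Sig (Suc b)) c" using step by (intro assms(1)) (auto simp: gens_def)
  then show ?case using step by (simp add: ascent_def)
qed simp

text \<open>The entries increase strictly and the affine ascent keeps their spread at most N, so
  they are consecutive integers; the fixed sum determines the first.\<close>

lemma no_descent_id:
  assumes c: "window N c" and asc: "\<And>s. s \<in> gens N \<Longrightarrow> ascent N s c"
  shows "c = id_window N"
proof -
  have len: "length c = Suc N" using c by (simp add: window_def)
  note inc = no_descent_increasing[OF asc]
  have "ascent N Aff c" by (intro asc) (auto simp: gens_def)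
  then have "c ! N < c ! 0 + int (Suc N)" by (simp add: ascent_def)
  then have nth: "c ! a = c ! 0 + int a" if "a \<le> N" for a
    using inc[of 0 a] inc[of a N] that by auto
  have "sum_list c = (\<Sum>a<Suc N. c ! a)"
    by (simp add: sum_list_sum_nth len atLeast0LessThan)
  also have "\<dots> = (\<Sum>a<Suc N. (c ! 0 - 1) + id_window N ! a)"
  proof (rule sum.cong)
    show "c ! a = c ! 0 - 1 + id_window N ! a" if "a \<in> {..<Suc N}" for a
      using nth[of a] that by (simp add: nth_id_window less_Suc_eq_le)
  qed simp
  also have "\<dots> = int (Suc N) * (c ! 0 - 1) + (\<Sum>a<Suc N. id_window N ! a)"
    by (simp only: sum.distrib sum_constant card_lessThan)
  also have "(\<Sum>a<Suc N. id_window N ! a) = sum_list (id_window N)"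
    by (simp add: sum_list_sum_nth atLeast0LessThan)
  finally have "int (Suc N) * (c ! 0 - 1) = 0"
    using c window_id[of N] by (simp add: window_def)
  then have "c ! 0 = 1" by simp
  then have "c ! a = id_window N ! a" if "a \<le> N" for a
    using nth[OF that] that by (simp add: nth_id_window)
  then show ?thesis
    by (intro nth_equalityI) (auto simp: len id_window_def)
qed

text \<open>Sorting by descents: each lowers the inversion number, and only
  \<open>id_window N\<close> has no descent. Read backwards, the sorting letters form the
  word.\<close>

lemma window_expression:
  assumes N: "N \<ge> 1" and "window N c"
  shows "\<exists>u\<in>lists (gens N). ascending N u (id_window N) \<and> run N u (id_window N) = c"
  using assms(2)
proof (induction "nat (inversions N c)" arbitrary: c rule: less_induct)
  case less
  show ?case
  proof (cases "\<exists>s\<in>gens N. \<not> ascent N s c")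
    case True
    then obtain s where s: "s \<in> gens N" "\<not> ascent N s c" by auto
    have "inversions N (act N s c) = inversions N c - 1"
      using inversions_act[OF N less.prems s(1)] s(2) by simp
    then have "nat (inversions N (act N s c)) < nat (inversions N c)"
      using inversions_nonneg[of N "act N s c"] by simp
    from less.hyps[OF this window_act[OF N less.prems s(1)]]
    obtain u where "u \<in> lists (gens N)" "ascending N u (id_window N)"
      "run N u (id_window N) = act N s c" by auto
    moreover have "length c = Suc N" using less.prems by (simp add: window_def)
    ultimately show ?thesis
      using s act_act[OF N s(1)] ascent_act[OF N less.prems s(1)]
      by (intro bexI[of _ "u @ [s]"]) (auto simp: ascending_append)
  next
    case False
    then show ?thesis using no_descent_id[OF less.prems]
      by (intro bexI[of _ "[]"]) auto
  qed
qed

section \<open>Two descents of one window\<close>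

lemma descent_commute:
  assumes "s \<in> gens N" "t \<in> gens N" "affine_matrix N s t = 2" "length c = Suc N"
    "\<not> ascent N t c"
  shows "\<not> ascent N t (act N s c)"
  using assms(1)
proof (cases rule: gens_cases)
  case s: (Sig i)
  show ?thesis using assms(2)
  proof (cases rule: gens_cases)
    case (Sig k)
    then have "i \<noteq> k" "i \<noteq> k - 1" "k \<noteq> i - 1" "i - 1 \<noteq> k - 1"
      using s assms(3) by (auto simp: affine_matrix_def cycle_step_def split: if_splits)
    then show ?thesis using s Sig assms(4,5) by (simp add: act_def ascent_def)
  next
    case Aff
    then have "i \<noteq> 1" "i \<noteq> N" using s assms(3)
      by (auto simp: affine_matrix_def cycle_step_def split: if_splits)
    then have "i \<noteq> 0" "i - 1 \<noteq> 0" "i \<noteq> N" "i - 1 \<noteq> N" using s by auto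
    then show ?thesis using s Aff assms(4,5) by (simp add: act_def ascent_def)
  qed
next
  case s: Aff
  show ?thesis using assms(2)
  proof (cases rule: gens_cases)
    case (Sig i)
    then have "i \<noteq> 1" "i \<noteq> N" using s assms(3)
      by (auto simp: affine_matrix_def cycle_step_def split: if_splits)
    then have "i \<noteq> 0" "i - 1 \<noteq> 0" "i \<noteq> N" "i - 1 \<noteq> N" using Sig by auto
    then show ?thesis using s Sig assms(4,5) by (simp add: act_def ascent_def)
  qed (use s assms in \<open>simp add: affine_matrix_def\<close>)
qed

text \<open>Two neighbouring descents put the three entries involved, up to the affine shift, in
  decreasing order, so each letter of either braid word removes an inversion.\<close>

lemma descent_braid_step:
  assumes "N \<ge> 2" "cycle_step N s t" "window N c" "\<not> ascent N s c" "\<not> ascent N t c"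
  shows "\<not> ascent N t (act N s c)" "\<not> ascent N s (act N t (act N s c))"
    "\<not> ascent N s (act N t c)" "\<not> ascent N t (act N s (act N t c))"
proof -
  have len: "length c = Suc N" using assms by (simp add: window_def)
  have "\<not> ascent N t (act N s c) \<and> \<not> ascent N s (act N t (act N s c)) \<and>
    \<not> ascent N s (act N t c) \<and> \<not> ascent N t (act N s (act N t c))"
    using assms(2)
  proof (cases rule: cycle_step_cases)
    case (Sig_Sig i)
    then show ?thesis using assms len by (simp add: act_def ascent_def nth_list_update)
  next
    case Sig_Aff
    then show ?thesis using assms len by (auto simp: act_def ascent_def nth_list_update)
  next
    case Aff_Sig
    then show ?thesis using assms len by (auto simp: act_def ascent_def nth_list_update)
  qed
  then show "\<not> ascent N t (act N s c)" "\<not> ascent N s (act N t (act N s c))"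
    "\<not> ascent N s (act N t c)" "\<not> ascent N t (act N s (act N t c))" by auto
qed

lemma descent_braid:
  assumes "N \<ge> 2" "affine_matrix N s t = 3" "window N c" "\<not> ascent N s c" "\<not> ascent N t c"
  shows "\<not> ascent N t (act N s c)" "\<not> ascent N s (act N t (act N s c))"
  using affine_matrix_3_cases[OF assms(2)] descent_braid_step assms by metis+

section \<open>Braid moves and equality in the group\<close>

abbreviation (input) braid_equiv :: "nat \<Rightarrow> gen list \<Rightarrow> gen list \<Rightarrow> bool" where
  "braid_equiv N \<equiv> (braid_move (gens N) (affine_matrix N))\<^sup>*\<^sup>*"

lemma affine_matrix_sym: "affine_matrix N s t = affine_matrix N t s"
  by (auto simp: affine_matrix_def)

lemma braid_move_cox_eq:
  assumes N: "N \<ge> 1" and "braid_move (gens N) (affine_matrix N) u v"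
  shows "cox_eq (gens N) (affine_matrix N) u v"
  using assms(2)
proof cases
  case (1 s t p q)
  define y where "y s = word_class N [s]" for s
  have wc: "word_class N (a # b) = y a \<otimes>\<^bsub>affine_group N\<^esub> word_class N b"
    if "a \<in> gens N" "b \<in> lists (gens N)" for a b
    unfolding y_def by (rule word_class_Cons[OF that])
  note rel = affine_group_relations[where N = N, folded y_def]
  have q: "word_class N q \<in> carrier (affine_group N)"
    using 1 by (simp add: word_class_closed)
  have alt: "alternating a b k \<in> lists (gens N)" if "a \<in> gens N" "b \<in> gens N" for a b k
    using that by (induction k arbitrary: a b) auto
  have "word_class N (alternating s t (affine_matrix N s t) @ q) =
    word_class N (alternating t s (affine_matrix N s t) @ q)"
  proof (cases rule: affine_matrix_cases[of s t N])
    case 2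
    then show ?thesis using 1 rel(2)[OF _ _ q, of s t] by (simp add: numeral_eq_Suc wc)
  next
    case 3
    then show ?thesis using 1 rel(4)[OF _ _ q, of s t] by (simp add: numeral_eq_Suc wc)
  qed (use 1 in simp)
  then have "cox_eq (gens N) (affine_matrix N) (alternating s t (affine_matrix N s t) @ q)
    (alternating t s (affine_matrix N s t) @ q)"
    using 1 alt by (subst (asm) word_class_eq_iff) auto
  from cox_eq_append[OF cox_refl this, of p] show ?thesis
    using 1 by simp
qed

lemma braid_equiv_cox_eq:
  assumes "N \<ge> 1" "braid_equiv N u v" "u \<in> lists (gens N)"
  shows "cox_eq (gens N) (affine_matrix N) u v"
  using assms(2)
  by induction (auto intro: cox_refl[OF assms(3)] cox_trans braid_move_cox_eq[OF assms(1)])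

lemma braid_equiv_append:
  assumes "braid_equiv N u v" "q \<in> lists (gens N)"
  shows "braid_equiv N (u @ q) (v @ q)"
  using assms(1)
proof induction
  case (step v w)
  from step(2) have "braid_move (gens N) (affine_matrix N) (v @ q) (w @ q)"
  proof cases
    case (1 s t a b)
    then show ?thesis
      using braid_move.intros[of s "gens N" t "affine_matrix N" a "b @ q"] assms(2) by simp
  qed
  then show ?case using step by (simp add: rtranclp.rtrancl_into_rtrancl)
qed simp

section \<open>Matsumoto's theorem\<close>

text \<open>If the two words end in different letters \<open>s\<close> and \<open>t\<close>, both are descents
  of the common window, so it also has reduced words ending in the two alternating words in \<open>s\<close> and \<open>t\<close>.\<close>

lemma ascending_braid_equiv:
  assumes N: "N \<ge> 2"
    and "u \<in> lists (gens N)" "v \<in> lists (gens N)"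
    and "ascending N u (id_window N)" "ascending N v (id_window N)"
    and "run N u (id_window N) = run N v (id_window N)"
  shows "braid_equiv N u v"
  using assms(2-)
proof (induction "length u" arbitrary: u v rule: less_induct)
  case less
  have N1: "N \<ge> 1" using N by simp
  let ?e = "id_window N"
  define f where "f = run N u ?e"
  have f: "window N f" unfolding f_def using less by (intro window_run[OF N1 window_id])
  have flen: "length f = Suc N" using f by (simp add: window_def)
  have "int (length u) = int (length v)"
    using less.prems ascending_iff_inversions[OF N1 window_id] by (simp add: inversions_id)
  then have len: "length u = length v" by simp
  show ?case
  proof (cases u rule: rev_cases)
    case Nil
    then show ?thesis using len by simp
  next
    case u: (snoc u1 s)
    then obtain v1 t where v: "v = v1 @ [t]" using len by (cases v rule: rev_cases) auto
    have st: "s \<in> gens N" "t \<in> gens N" "u1 \<in> lists (gens N)" "v1 \<in> lists (gens N)"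
      using u v less.prems by auto
    have asc: "ascending N u1 ?e" "ascending N v1 ?e" "ascent N s (run N u1 ?e)" "ascent N t (run N v1 ?e)"
      using u v less.prems by (auto simp: ascending_append)
    have u1: "run N u1 ?e = act N s f"
      using u act_act[OF N1 st(1), of "run N u1 ?e"] by (simp add: f_def id_window_def)
    have v1: "run N v1 ?e = act N t f"
      using v act_act[OF N1 st(2), of "run N v1 ?e"] less.prems(5) by (simp add: f_def id_window_def)
    have des: "\<not> ascent N s f" "\<not> ascent N t f"
      using ascent_act[OF N1 f st(1)] ascent_act[OF N1 f st(2)] asc u1 v1 by auto
    have IH: "braid_equiv N (a @ [p]) (b @ [p])"
      if "a \<in> lists (gens N)" "b \<in> lists (gens N)" "p \<in> gens N" "ascending N a ?e" "ascending N b ?e"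
        "run N a ?e = run N b ?e" "length a < length u" for a b p
      using less.hyps[OF that(7,1,2,4,5,6)] that(3) by (intro braid_equiv_append) auto
    have aa: "act N p (act N p d) = d" if "p \<in> gens N" "window N d" for p d
      using act_act[OF N1 that(1)] that(2) by (simp add: window_def)
    have wa: "window N (act N p d)" if "p \<in> gens N" "window N d" for p d
      using window_act[OF N1 that(2,1)] .
    have up: "ascent N p (act N p d)" if "p \<in> gens N" "window N d" "\<not> ascent N p d" for p d
      using ascent_act[OF N1 that(2,1)] that(3) by simp
    have u1len: "length u1 < length u" using u by simp
    have v1len: "length v1 < length u" using v len by simp
    show ?thesis
    proof (cases rule: affine_matrix_cases[of s t N])
      case 1
      then show ?thesis
        using IH[of u1 v1 s] st asc u1 v1 u v by auto
    next
      case 2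
      \<comment> \<open>Undoing both descents leaves a window whose reduced word \<open>z\<close>
        extends to reduced words for \<open>f\<close> ending in \<open>t, s\<close> and in
        \<open>s, t\<close>. These differ by one braid move and share their last letters with
        \<open>u\<close> and \<open>v\<close>.\<close>
      define g where "g = act N t (act N s f)"
      have g': "g = act N s (act N t f)"
        unfolding g_def using act_commute[OF st(1,2) 2(2) flen] by simp
      have g: "window N g" using f st wa by (simp add: g_def)
      obtain z where z: "z \<in> lists (gens N)" "ascending N z ?e" "run N z ?e = g"
        using window_expression[OF N1 g] by auto
      have d1: "\<not> ascent N t (act N s f)"
        using descent_commute[OF st(1,2) 2(2) flen des(2)] .
      have d2: "\<not> ascent N s (act N t f)"
        using descent_commute[OF st(2,1) _ flen des(1)] 2(2) affine_matrix_sym by metis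
      have zt: "act N t g = act N s f" "ascent N t g"
        unfolding g_def using aa up st f wa d1 by auto
      have zs: "act N s g = act N t f" "ascent N s g"
        unfolding g' using aa up st f wa d2 by auto
      have "braid_equiv N u ((z @ [t]) @ [s])"
        unfolding u by (rule IH) (use u1len st asc z zt u1 in \<open>auto simp: ascending_append\<close>)
      also have "braid_move (gens N) (affine_matrix N) (z @ [t, s]) (z @ [s, t])"
        using braid_move.intros[of t "gens N" s "affine_matrix N" z "[]"] st z 2
        by (simp add: affine_matrix_sym[of N t s] numeral_eq_Suc)
      then have "braid_equiv N ((z @ [t]) @ [s]) ((z @ [s]) @ [t])" by simp
      also have "braid_equiv N ((z @ [s]) @ [t]) v"
        unfolding v
      proof (rule IH)
        show "length (z @ [s]) < length u"
        proof -
          have "int (length (z @ [s])) = int (length v1)"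
            using ascending_iff_inversions[OF N1 window_id, of "z @ [s]"]
              ascending_iff_inversions[OF N1 window_id, of v1] z zs st asc v1
            by (simp add: ascending_append)
          then show ?thesis using v1len by simp
        qed
      qed (use st asc z zs v1 in \<open>auto simp: ascending_append\<close>)
      finally show ?thesis .
    next
      case 3
      have m_ts: "affine_matrix N t s = 3" using 3 affine_matrix_sym by simp
      \<comment> \<open>As before, now undoing the longest element of the subgroup generated by
        \<open>s\<close> and \<open>t\<close>; the two extensions of \<open>z\<close> end in the two
        sides of the braid relation.\<close>
      define g where "g = act N s (act N t (act N s f))"
      have g': "g = act N t (act N s (act N t f))"
        unfolding g_def using act_braid[OF N 3(2) flen] by simp
      have g: "window N g" using f st wa by (simp add: g_def)
      obtain z where z: "z \<in> lists (gens N)" "ascending N z ?e" "run N z ?e = g"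
        using window_expression[OF N1 g] by auto
      note d1 = descent_braid[OF N 3(2) f des]
      note d2 = descent_braid[OF N m_ts f des(2,1)]
      have zt: "act N s g = act N t (act N s f)" "ascent N s g"
        "act N t (act N s g) = act N s f" "ascent N t (act N s g)"
        unfolding g_def using aa up st f wa d1 by auto
      have zs: "act N t g = act N s (act N t f)" "ascent N t g"
        "act N s (act N t g) = act N t f" "ascent N s (act N t g)"
        unfolding g' using aa up st f wa d2 by auto
      have "braid_equiv N u ((z @ [s, t]) @ [s])"
        unfolding u by (rule IH) (use u1len st asc z zt u1 in \<open>auto simp: ascending_append\<close>)
      also have "braid_move (gens N) (affine_matrix N) (z @ [s, t, s]) (z @ [t, s, t])"
        using braid_move.intros[of s "gens N" t "affine_matrix N" z "[]"] st z 3
        by (simp add: numeral_eq_Suc)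
      then have "braid_equiv N ((z @ [s, t]) @ [s]) ((z @ [t, s]) @ [t])" by simp
      also have "braid_equiv N ((z @ [t, s]) @ [t]) v"
        unfolding v
      proof (rule IH)
        show "length (z @ [t, s]) < length u"
        proof -
          have "int (length (z @ [t, s])) = int (length v1)"
            using ascending_iff_inversions[OF N1 window_id, of "z @ [t, s]"]
              ascending_iff_inversions[OF N1 window_id, of v1] z zs st asc v1
            by (simp add: ascending_append)
          then show ?thesis using v1len by simp
        qed
      qed (use st asc z zs v1 in \<open>auto simp: ascending_append\<close>)
      finally show ?thesis .
    qed
  qed
qed

section \<open>Blocks of canonical expressions\<close>

lemma act_Sig_append: "act N (Sig (Suc (length A))) (A @ p # q # C) = A @ q # p # C"
  by (simp add: act_def nth_append list_update_append)

lemma ascent_Sig_append: "ascent N (Sig (Suc (length A))) (A @ p # q # C) \<longleftrightarrow> p < q"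
  by (simp add: ascent_def nth_append)

lemma act_Aff:
  assumes "N = Suc (length R)"
  shows "act N Aff (a # R @ [b]) = (b - int (Suc N)) # R @ [a + int (Suc N)]"
  using assms by (simp add: act_def nth_append list_update_append)

lemma ascent_Aff:
  assumes "N = Suc (length R)"
  shows "ascent N Aff (a # R @ [b]) \<longleftrightarrow> b < a + int (Suc N)"
  using assms by (simp add: ascent_def nth_append)

lemma up_word_Cons: "k \<le> l \<Longrightarrow> up_word k l = Sig k # up_word (Suc k) l"
  unfolding up_word_def by (subst upt_rec) auto

lemma up_word_empty: "l < k \<Longrightarrow> up_word k l = []"
  by (simp add: up_word_def)

lemma down_word_Cons: "k \<le> Suc l \<Longrightarrow> down_word (Suc l) k = Sig (Suc l) # down_word l k"
  by (simp add: down_word_def)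

lemma down_word_empty: "l < k \<Longrightarrow> down_word l k = []"
  by (simp add: down_word_def)

text \<open>The word carries \<open>p\<close> to the right through \<open>B\<close>, and each letter
  compares \<open>p\<close> with the next entry of \<open>B\<close>. In the induction that entry
  moves over to \<open>A\<close>.\<close>

lemma run_up_word:
  "run N (up_word (Suc (length A)) (length A + length B)) (A @ p # B @ C) = A @ B @ p # C \<and>
   ((\<forall>b\<in>set B. p < b) \<longrightarrow> ascending N (up_word (Suc (length A)) (length A + length B)) (A @ p # B @ C))"
proof (induction B arbitrary: A)
  case Nil
  then show ?case by (simp add: up_word_empty)
next
  case (Cons b B)
  from Cons[of "A @ [b]"] show ?case
    by (simp add: up_word_Cons act_Sig_append ascent_Sig_append)
qed

text \<open>Here \<open>q\<close> travels to the left, so the first letter meets the last entry of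
  \<open>B\<close> and the induction runs from that end.\<close>

lemma run_down_word:
  "run N (down_word (length A + length B) (Suc (length A))) (A @ B @ q # C) = A @ q # B @ C \<and>
   ((\<forall>b\<in>set B. b < q) \<longrightarrow> ascending N (down_word (length A + length B) (Suc (length A))) (A @ B @ q # C))"
proof (induction B arbitrary: C rule: rev_induct)
  case Nil
  then show ?case by (simp add: down_word_empty)
next
  case (snoc b B)
  from snoc[of "b # C"] act_Sig_append[of N "A @ B" b q C] ascent_Sig_append[of N "A @ B" b q C]
  show ?case by (simp add: down_word_Cons)
qed

lemma append_Cons_eq_append_long:
  "A @ p # B = C @ D \<Longrightarrow> length A < length C \<Longrightarrow> \<exists>E. C = A @ p # E \<and> B = E @ D"
proof (induction A arbitrary: C)
  case Nil
  then show ?case by (cases C) auto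
next
  case (Cons a A)
  then show ?case by (cases C) auto
qed

lemma append_Cons_eq_append_short:
  "A @ q # B = C @ D \<Longrightarrow> length C \<le> length A \<Longrightarrow> \<exists>E. A = C @ E \<and> D = E @ q # B"
proof (induction C arbitrary: A)
  case (Cons c C)
  then show ?case by (cases A) auto
qed simp

text \<open>List decompositions rather than indices allow windows to be split further. The position
  \<open>r\<close> counts from 1; \<open>i\<close> counts from 0 in the list from which
  \<open>p\<close> is already removed.\<close>

definition block :: "int list \<Rightarrow> nat \<Rightarrow> nat \<Rightarrow> int \<Rightarrow> int \<Rightarrow> int list \<Rightarrow> bool" where
  "block c r i p q R \<longleftrightarrow>
     (\<exists>A B A' B'. c = A @ p # B \<and> r = Suc (length A) \<and> A @ B = A' @ q # B' \<and> i = length A' \<and> R = A' @ B')"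

lemma block_exists:
  assumes "length c = Suc N" "1 \<le> r" "r \<le> Suc N" "i < N"
  shows "\<exists>p q R. block c r i p q R"
proof -
  let ?A = "take (r - 1) c" and ?B = "drop r c"
  have "c = ?A @ c ! (r - 1) # ?B" "r = Suc (length ?A)"
    using assms id_take_nth_drop[of "r - 1" c] by auto
  moreover have "i < length (?A @ ?B)" using assms by simp
  then have "?A @ ?B = take i (?A @ ?B) @ (?A @ ?B) ! i # drop (Suc i) (?A @ ?B)"
    "i = length (take i (?A @ ?B))"
    by (rule id_take_nth_drop) (use assms in auto)
  ultimately show ?thesis unfolding block_def by blast
qed

lemma block_set: "block c r i p q R \<Longrightarrow> p \<in> set c \<and> q \<in> set c \<and> set R \<subseteq> set c"
proof -
  assume "block c r i p q R"
  then obtain A B A' B' where "c = A @ p # B" "A @ B = A' @ q # B'" "R = A' @ B'"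
    by (auto simp: block_def)
  moreover from this(2) have "set A \<union> set B = insert q (set A' \<union> set B')"
    by (metis Un_insert_right list.set(2) set_append)
  ultimately show ?thesis by auto
qed

lemma length_block: "block c r i p q R \<Longrightarrow> length c = Suc (Suc (length R))"
proof -
  assume "block c r i p q R"
  then obtain A B A' B' where "c = A @ p # B" "A @ B = A' @ q # B'" "R = A' @ B'"
    by (auto simp: block_def)
  moreover from this(2) have "length A + length B = Suc (length A' + length B')"
    by (metis add_Suc_right length_Cons length_append)
  ultimately show ?thesis by simp
qed

text \<open>\<open>up_word\<close> takes \<open>p\<close> to the end, \<open>down_word\<close> takes
  \<open>q\<close> to the front, and \<open>Aff\<close> exchanges the two with opposite shifts. In
  an increasing window \<open>p\<close> passes only larger entries and \<open>q\<close> only smaller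
  ones.\<close>

lemma run_block:
  assumes "block c r i p q R" "length c = Suc N"
  shows "run N (h_word N r i @ [Aff]) c = (p - int (Suc N)) # R @ [q + int (Suc N)]"
    and "sorted_wrt (<) c \<Longrightarrow> p < q + int (Suc N) \<Longrightarrow> ascending N (h_word N r i @ [Aff]) c"
proof -
  obtain A B A' B' where b: "c = A @ p # B" "r = Suc (length A)" "A @ B = A' @ q # B'" "i = length A'" "R = A' @ B'"
    using assms(1) by (auto simp: block_def)
  have N: "N = length A + length B" "N = Suc (length R)"
    using assms(2) length_block[OF assms(1)] b by auto
  have up: "run N (up_word r N) c = A' @ q # B' @ [p]"
    using run_up_word[of N A B p "[]"] b N b(3) by (metis append.assoc append_Cons append_Nil2)
  have down: "run N (down_word i 1) (A' @ q # B' @ [p]) = q # R @ [p]"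
    using run_down_word[of N "[]" A' q "B' @ [p]"] b by simp
  show "run N (h_word N r i @ [Aff]) c = (p - int (Suc N)) # R @ [q + int (Suc N)]"
    by (simp add: h_word_def up down[simplified] act_Aff[OF N(2)] del: of_nat_Suc)
  assume s: "sorted_wrt (<) c" and pq: "p < q + int (Suc N)"
  have "sorted_wrt (<) (A' @ q # B')"
    using s unfolding b(1) b(3)[symmetric] by (auto simp: sorted_wrt_append)
  then have "ascending N (down_word i 1) (A' @ q # B' @ [p])"
    using run_down_word[of N "[]" A' q "B' @ [p]"] b(4) by (simp add: sorted_wrt_append)
  moreover have "ascending N (up_word r N) c"
    using run_up_word[of N A B p "[]"] b(1,2) N(1) s by (simp add: sorted_wrt_append)
  moreover have "ascent N Aff (q # R @ [p])"
    using pq ascent_Aff[OF N(2)] by blast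
  ultimately show "ascending N (h_word N r i @ [Aff]) c"
    by (simp add: h_word_def ascending_append up down[simplified])
qed

text \<open>If \<open>i + 1 < r\<close>, the removed \<open>q\<close> stood to the left of
  \<open>p\<close>, so one entry fewer of \<open>R\<close> comes from that side; the conditional
  term accounts for this.\<close>

lemma block_remaining:
  assumes "block c r i p q R" "sorted_wrt (<) c"
  shows "sorted_wrt (<) R"
    and "e < length R \<Longrightarrow> i \<le> e \<Longrightarrow> q < R ! e"
    and "e < length R \<Longrightarrow> e + 1 + (if i + 1 < r then 1 else 0) < r \<Longrightarrow> R ! e < p"
proof -
  obtain A B A' B' where b: "c = A @ p # B" "r = Suc (length A)" "A @ B = A' @ q # B'" "i = length A'" "R = A' @ B'"
    using assms(1) by (auto simp: block_def)
  have s: "sorted_wrt (<) (A' @ q # B')"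
    using assms(2) unfolding b(1) b(3)[symmetric] by (auto simp: sorted_wrt_append)
  have A: "a < p" if "a \<in> set A" for a
    using assms(2) that unfolding b(1) by (auto simp: sorted_wrt_append)
  show "sorted_wrt (<) R"
    using s unfolding b(5) by (auto simp: sorted_wrt_append)
  show "q < R ! e" if "e < length R" "i \<le> e"
  proof -
    have "R ! e \<in> set B'" using that b(4,5) by (simp add: nth_append)
    then show ?thesis using s by (simp add: sorted_wrt_append)
  qed
  show "R ! e < p" if "e < length R" "e + 1 + (if i + 1 < r then 1 else 0) < r"
  proof (cases "length A' < length A")
    case True
    then obtain A'' where "A = A' @ q # A''" "B' = A'' @ B"
      using append_Cons_eq_append_long[OF b(3)[symmetric]] by auto
    then have "R ! e = (A' @ A'') ! e" "e < length (A' @ A'')" "set (A' @ A'') \<subseteq> set A"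
      using that b True by (auto simp: nth_append)
    then have "R ! e \<in> set A" by (metis nth_mem subsetD)
    then show ?thesis by (rule A)
  next
    case False
    then obtain A'' where "A' = A @ A''"
      using append_Cons_eq_append_short[OF b(3)[symmetric]] by auto
    then have "R ! e \<in> set A"
      using that b False by (auto simp: nth_append)
    then show ?thesis by (rule A)
  qed
qed

text \<open>The invariant carried from block to block. The bounds on all entries make
  \<open>Aff\<close> an ascent and the next window increasing; the bounds on \<open>p\<close> and
  \<open>q\<close> alone make the block count for the translation part.\<close>

definition good_block :: "nat \<Rightarrow> int list \<Rightarrow> nat \<Rightarrow> nat \<Rightarrow> int \<Rightarrow> int \<Rightarrow> int list \<Rightarrow> bool" where
  "good_block N c r i p q R \<longleftrightarrow> block c r i p q R \<and> length c = Suc N \<and> sorted_wrt (<) c \<and>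
     p \<le> int (Suc N) \<and> 1 \<le> q \<and> (\<forall>y\<in>set c. p - int (Suc N) < y \<and> y < q + int (Suc N))"

lemma good_block_sorted:
  assumes "good_block N c r i p q R"
  shows "sorted_wrt (<) ((p - int (Suc N)) # R @ [q + int (Suc N)])"
proof -
  have b: "block c r i p q R" "sorted_wrt (<) c" "\<And>y. y \<in> set c \<Longrightarrow> p - int (Suc N) < y \<and> y < q + int (Suc N)"
    using assms by (auto simp: good_block_def)
  have "p - int (Suc N) < q" "\<And>y. y \<in> set R \<Longrightarrow> p - int (Suc N) < y \<and> y < q + int (Suc N)"
    using block_set[OF b(1)] b(3) by blast+
  then show ?thesis
    using block_remaining(1)[OF b(1,2)] by (auto simp: sorted_wrt_append)
qed

lemma good_block_run:
  assumes "good_block N c r i p q R"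
  shows "run N (h_word N r i @ [Aff]) c = (p - int (Suc N)) # R @ [q + int (Suc N)]"
    and "ascending N (h_word N r i @ [Aff]) c"
proof -
  have b: "block c r i p q R" "length c = Suc N" "sorted_wrt (<) c" "p < q + int (Suc N)"
    using assms block_set[of c r i p q R] by (auto simp: good_block_def)
  show "run N (h_word N r i @ [Aff]) c = (p - int (Suc N)) # R @ [q + int (Suc N)]"
    "ascending N (h_word N r i @ [Aff]) c"
    using run_block[OF b(1,2)] b(3,4) by auto
qed

lemma good_block_id:
  assumes "1 \<le> r" "r \<le> Suc N" "i < N"
  shows "\<exists>p q R. good_block N (id_window N) r i p q R"
proof -
  obtain p q R where b: "block (id_window N) r i p q R"
    using block_exists[of "id_window N" N r i] assms by auto
  have set: "set (id_window N) = {1..int (Suc N)}" by (simp add: id_window_def)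
  have "sorted_wrt (<) (id_window N)" by (simp add: id_window_def)
  moreover have "p \<le> int (Suc N)" "1 \<le> q" "1 \<le> p" "q \<le> int (Suc N)"
    using block_set[OF b] unfolding set by auto
  ultimately show ?thesis
    using b by (intro exI) (auto simp: good_block_def set)
qed

text \<open>The new window has the extreme entries \<open>p - int (Suc N)\<close> and
  \<open>q + int (Suc N)\<close>, so the invariant passes on once the next lowered entry is below
  \<open>p\<close> and the next raised one above \<open>q\<close>. The assumptions on
  \<open>r'\<close> and \<open>i'\<close> yield these two facts.\<close>

lemma good_block_step:
  assumes g: "good_block N c r i p q R"
    and ii: "(i' = 0 \<and> r' = 1) \<or> (1 \<le> i' \<and> i' \<le> N - 1 \<and> 1 \<le> r' \<and> r' \<le> N)"
    and le: "r' \<le> r" "i \<le> i'"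
    and iv: "i + 1 < r \<longrightarrow> r' < r"
    and v: "i' + 1 < r' \<longrightarrow> i < i'"
  shows "\<exists>p' q' R'. good_block N ((p - int (Suc N)) # R @ [q + int (Suc N)]) r' i' p' q' R'"
proof -
  define M where "M = int (Suc N)"
  define d where "d = (p - M) # R @ [q + M]"
  have b: "block c r i p q R" "length c = Suc N" "sorted_wrt (<) c" "p \<le> M" "1 \<le> q"
    using g by (auto simp: good_block_def M_def)
  have R: "N = Suc (length R)" using length_block[OF b(1)] b(2) by simp
  have sd: "sorted_wrt (<) d"
    using good_block_sorted[OF g] by (simp only: d_def M_def)
  have ld: "length d = Suc N" using R by (simp add: d_def)
  obtain p' q' R' where b': "block d r' i' p' q' R'"
    using block_exists[OF ld, of r' i'] ii R by auto
  then obtain A B A' B' where d: "d = A @ p' # B" "r' = Suc (length A)" "A @ B = A' @ q' # B'" "i' = length A'"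
    by (auto simp: block_def)
  have M: "M > 0" by (simp add: M_def)
  have up: "(R @ [q + M]) ! e > q" if "i \<le> e" "e < N" for e
  proof (cases "e < length R")
    case True
    then show ?thesis using block_remaining(2)[OF b(1,3), of e] that by (simp add: nth_append)
  next
    case False
    then show ?thesis using that R M by (simp add: nth_append)
  qed
  have p': "p' = d ! (r' - 1)" and q': "q' = (A @ B) ! i'"
    using d by (simp_all add: nth_append)
  \<comment> \<open>Behind the front entry of \<open>d\<close>, position \<open>r'\<close> is index
    \<open>r' - 2\<close> of \<open>R\<close>. If \<open>q\<close> was taken from the left of
    \<open>p\<close>, \<open>iv\<close> makes up for the missing entry.\<close>
  have pp: "p' < p"
  proof (cases "r' = 1")
    case True
    then show ?thesis using M by (simp add: p' d_def)
  next
    case False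
    then obtain a where a: "r' = Suc (Suc a)" using d(2) by (cases "length A") auto
    then have "a < length R" using ii R by auto
    moreover from this have "p' = R ! a" using a by (simp add: p' d_def nth_append)
    ultimately show ?thesis
      using block_remaining(3)[OF b(1,3), of a] a le iv by auto
  qed
  \<comment> \<open>If \<open>p'\<close> is the front entry of \<open>d\<close>, then
    \<open>i'\<close> is an index of \<open>R @ [q + M]\<close>. Otherwise the front entry shifts
    the index by one: to the left of \<open>p'\<close> this is covered by \<open>v\<close>, to the
    right it is cancelled by the removal of \<open>p'\<close>.\<close>
  have qq: "q < q'"
  proof (cases A)
    case Nil
    then have "B = R @ [q + M]" using d(1) by (simp add: d_def)
    then show ?thesis using up[of i'] le ii R Nil by (auto simp: q')
  next
    case (Cons a A3)
    then obtain k where k: "i' = Suc k" using ii d(2) by (cases i') auto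
    have eq: "R @ [q + M] = A3 @ p' # B" using d(1) Cons by (simp add: d_def)
    have q'': "q' = (A3 @ B) ! k" using k Cons by (simp add: q')
    show ?thesis
    proof (cases "k < length A3")
      case True
      then have "i \<le> k" using v d(2) Cons k by auto
      moreover have "q' = (R @ [q + M]) ! k" using True unfolding eq q'' by (simp add: nth_append)
      ultimately show ?thesis using up[of k] ii k R by auto
    next
      case False
      then have "q' = (R @ [q + M]) ! i'" unfolding eq q'' k by (simp add: nth_append Suc_diff_le)
      then show ?thesis using up[of i'] le ii R by auto
    qed
  qed
  have "p' - M < y \<and> y < q' + M" if "y \<in> set d" for y
  proof -
    have "p - M \<le> y \<and> y \<le> q + M"
      using sd that by (auto simp: d_def sorted_wrt_append)
    then show ?thesis using pp qq by linarith
  qed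
  then have "good_block N d r' i' p' q' R'"
    using b' ld sd pp qq b by (auto simp: good_block_def M_def)
  then show ?thesis unfolding d_def M_def by blast
qed

definition block_window :: "nat \<Rightarrow> nat \<Rightarrow> (nat \<Rightarrow> nat) \<Rightarrow> (nat \<Rightarrow> nat) \<Rightarrow> int list" where
  "block_window N k j i = run N (affine_word N k j i []) (id_window N)"

lemma affine_word_0: "affine_word N 0 j i x = x"
  by (simp add: affine_word_def)

lemma affine_word_Suc:
  "affine_word N (Suc k) j i [] = affine_word N k j i [] @ h_word N (j (Suc k)) (i (Suc k)) @ [Aff]"
  by (simp add: affine_word_def)

lemma affine_word_append: "affine_word N k j i x = affine_word N k j i [] @ x"
  by (simp add: affine_word_def)

lemma block_window_0: "block_window N 0 j i = id_window N"
  by (simp add: block_window_def affine_word_0)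

lemma block_window_Suc:
  "block_window N (Suc k) j i = run N (h_word N (j (Suc k)) (i (Suc k)) @ [Aff]) (block_window N k j i)"
  by (simp add: block_window_def affine_word_Suc)

lemma canonical_good_block:
  assumes "N \<ge> 1" "pairwise_inequalities N m j i" "k < m"
  shows "\<exists>p q R. good_block N (block_window N k j i) (j (Suc k)) (i (Suc k)) p q R"
  using assms(3)
proof (induction k)
  case 0
  then show ?case
    unfolding block_window_0 using assms by (intro good_block_id) (auto simp: pairwise_inequalities_def)
next
  case (Suc k)
  then obtain p q R where g: "good_block N (block_window N k j i) (j (Suc k)) (i (Suc k)) p q R"
    by auto
  have "Suc (Suc k) \<in> {2..m}" using Suc by simp
  then have "let s = Suc (Suc k) in
        ((i s = 0 \<and> j s = 1) \<or> (1 \<le> i s \<and> i s \<le> N - 1 \<and> 1 \<le> j s \<and> j s \<le> N)) \<and>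
        j s \<le> j (s - 1) \<and> i (s - 1) \<le> i s \<and>
        (j (s - 1) > i (s - 1) + 1 \<longrightarrow> j s < j (s - 1)) \<and>
        (j s > i s + 1 \<longrightarrow> i (s - 1) < i s)"
    using assms(2) unfolding pairwise_inequalities_def Let_def by blast
  then show ?case
    unfolding block_window_Suc good_block_run(1)[OF g]
    by (intro good_block_step[OF g]) (simp_all add: Let_def)
qed

lemma canonical_blocks_sorted:
  assumes "N \<ge> 1" "pairwise_inequalities N m j i" "k \<le> m"
  shows "sorted_wrt (<) (block_window N k j i)"
proof (cases k)
  case 0
  then show ?thesis by (simp add: block_window_0 id_window_def)
next
  case (Suc l)
  then obtain p q R where g: "good_block N (block_window N l j i) (j (Suc l)) (i (Suc l)) p q R"
    using canonical_good_block[OF assms(1,2), of l] assms(3) by auto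
  show ?thesis
    unfolding Suc block_window_Suc good_block_run(1)[OF g] by (rule good_block_sorted[OF g])
qed

lemma canonical_blocks_ascending:
  assumes "N \<ge> 1" "pairwise_inequalities N m j i" "k \<le> m"
  shows "ascending N (affine_word N k j i []) (id_window N)"
  using assms(3)
proof (induction k)
  case 0
  then show ?case by (simp add: affine_word_0)
next
  case (Suc k)
  then obtain p q R where g: "good_block N (block_window N k j i) (j (Suc k)) (i (Suc k)) p q R"
    using canonical_good_block[OF assms(1,2), of k] by auto
  show ?case
    using good_block_run(2)[OF g] Suc
    unfolding affine_word_Suc by (subst ascending_append) (simp add: block_window_def)
qed

text \<open>The window entry \<open>z = r + (N + 1) d\<close> with \<open>1 \<le> r \<le> N + 1\<close> has translation part \<open>d = (z - 1) div (N + 1)\<close>. These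
  sum to zero, so the sum of the positive ones is half the norm.\<close>

definition translation_size :: "nat \<Rightarrow> int list \<Rightarrow> int" where
  "translation_size N c = (\<Sum>z\<leftarrow>c. max 0 ((z - 1) div int (Suc N)))"

lemma translation_size_act_Sig:
  assumes "1 \<le> i" "i < length c"
  shows "translation_size N (act N (Sig i) c) = translation_size N c"
proof -
  define A C p q where "A = take (i - 1) c" and "C = drop (Suc i) c" and "p = c ! (i - 1)" and "q = c ! i"
  have c: "c = A @ p # q # C" and i: "i = Suc (length A)"
    using assms id_take_nth_drop[of "i - 1" c] Cons_nth_drop_Suc[of i c]
    by (simp_all add: A_def C_def p_def q_def)
  show ?thesis
    unfolding i c act_Sig_append by (simp add: translation_size_def)
qed

text \<open>\<open>Aff\<close> raises one translation part by one and lowers another by one; after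
  truncation at 0 the former gains at most one and the latter does not grow.\<close>

lemma translation_size_act_le:
  assumes "N \<ge> 1" "length c = Suc N" "s \<in> gens N"
  shows "translation_size N (act N s c) \<le> translation_size N c + (if s = Aff then 1 else 0)"
  using assms(3)
proof (cases rule: gens_cases)
  case (Sig i)
  then show ?thesis using translation_size_act_Sig[of i c N] assms by simp
next
  case Aff
  obtain a R b where c: "c = a # R @ [b]" "N = Suc (length R)"
    using assms by (cases c; cases "tl c" rule: rev_cases) auto
  define M where "M = int (Suc N)"
  have M: "M \<noteq> 0" by (simp add: M_def)
  have shift: "(a + M - 1) div M = (a - 1) div M + 1" "(b - M - 1) div M = (b - 1) div M - 1"
    using div_add_self2[OF M, of "a - 1"] div_add_self2[OF M, of "b - M - 1"]
    by (simp_all add: algebra_simps)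
  have "act N s c = (b - M) # R @ [a + M]"
    unfolding Aff c(1) M_def by (rule act_Aff[OF c(2)])
  then have "translation_size N (act N s c) = max 0 ((b - M - 1) div M) + (\<Sum>z\<leftarrow>R. max 0 ((z - 1) div M)) + max 0 ((a + M - 1) div M)"
    by (simp add: translation_size_def M_def del: of_nat_Suc)
  moreover have "translation_size N c = max 0 ((a - 1) div M) + (\<Sum>z\<leftarrow>R. max 0 ((z - 1) div M)) + max 0 ((b - 1) div M)"
    by (simp add: translation_size_def M_def c(1) del: of_nat_Suc)
  ultimately show ?thesis unfolding shift using Aff by simp
qed

lemma translation_size_run_le:
  assumes "N \<ge> 1" "length c = Suc N" "u \<in> lists (gens N)"
  shows "translation_size N (run N u c) \<le> translation_size N c + int (count_list u Aff)"
  using assms(3,2)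
proof (induction u arbitrary: c)
  case (Cons s u)
  then have "translation_size N (run N u (act N s c)) \<le> translation_size N (act N s c) + int (count_list u Aff)"
    by (intro Cons.IH) simp
  then show ?case
    using translation_size_act_le[OF assms(1), of c s] Cons.hyps Cons.prems by (auto split: if_splits)
qed simp

lemma translation_size_id: "translation_size N (id_window N) = 0"
proof -
  have "map (\<lambda>z. max 0 ((z - 1) div int (Suc N))) (id_window N) = map (\<lambda>z. 0) (id_window N)"
    by (intro map_cong) (auto simp: id_window_def)
  then show ?thesis unfolding translation_size_def by (simp only: sum_list_0)
qed

text \<open>The lowered entry counts zero before and after. The raised one has a nonnegative
  translation part, so its increase survives the truncation at 0.\<close>

lemma good_block_translation_size:
  assumes "good_block N c r i p q R"
  shows "translation_size N ((p - int (Suc N)) # R @ [q + int (Suc N)]) = translation_size N c + 1"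
proof -
  define M where "M = int (Suc N)"
  define f where "f z = max 0 ((z - 1) div M)" for z
  have M: "M > 0" by (simp add: M_def)
  have g: "p \<le> M" "1 \<le> q" using assms by (auto simp: good_block_def M_def)
  obtain A B A' B' where b: "c = A @ p # B" "A @ B = A' @ q # B'" "R = A' @ B'"
    using assms by (auto simp: block_def good_block_def)
  have "sum_list (map f (A @ B)) = sum_list (map f (A' @ q # B'))" by (simp only: b(2))
  then have "sum_list (map f c) = f p + f q + sum_list (map f R)" by (simp add: b(1,3))
  moreover have "(p - 1) div M \<le> 0" using g pos_imp_zdiv_pos_iff[OF M, of "p - 1"] by linarith
  moreover have "(p - M - 1) div M \<le> 0" using g M by (intro div_nonpos_pos_le0) auto
  moreover have "(q - 1) div M \<ge> 0" using g M by (simp add: pos_imp_zdiv_nonneg_iff)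
  moreover have "(q + M - 1) div M = (q - 1) div M + 1"
    using div_add_self2[of M "q - 1"] M by (simp add: algebra_simps)
  ultimately show ?thesis
    unfolding translation_size_def M_def[symmetric] f_def[abs_def, symmetric] by (simp add: f_def)
qed

lemma canonical_blocks_translation_size:
  assumes "N \<ge> 1" "pairwise_inequalities N m j i" "k \<le> m"
  shows "translation_size N (block_window N k j i) = int k"
  using assms(3)
proof (induction k)
  case 0
  then show ?case by (simp add: block_window_0 translation_size_id)
next
  case (Suc k)
  then obtain p q R where g: "good_block N (block_window N k j i) (j (Suc k)) (i (Suc k)) p q R"
    using canonical_good_block[OF assms(1,2), of k] by auto
  show ?case
    unfolding block_window_Suc good_block_run(1)[OF g] good_block_translation_size[OF g]
    using Suc by simp
qed

text \<open>A factor ending in \<open>l\<close> moves one entry to position \<open>l + 1\<close> and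
  leaves the first \<open>l\<close> entries increasing. The later factors end below \<open>l\<close>
  and touch only those.\<close>

lemma ascending_descending_up_words:
  assumes "\<forall>(k, l)\<in>set kls. 1 \<le> k \<and> k \<le> l \<and> l \<le> b" "sorted_wrt (\<lambda>x y. snd x > snd y) kls"
    "b < length c" "sorted_wrt (<) (take (Suc b) c)"
  shows "ascending N (concat (map (\<lambda>(k, l). up_word k l) kls)) c"
  using assms
proof (induction kls arbitrary: b c)
  case (Cons kl kls)
  obtain k l where kl: "kl = (k, l)" "1 \<le> k" "k \<le> l" "l \<le> b" using Cons.prems by (cases kl) auto
  define A B C p where "A = take (k - 1) c" and "B = take (l + 1 - k) (drop k c)"
    and "C = drop (Suc l) c" and "p = c ! (k - 1)"
  have c: "c = A @ p # B @ C"
  proof -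
    have "c = A @ p # drop k c"
      using id_take_nth_drop[of "k - 1" c] kl Cons.prems by (simp add: A_def p_def)
    moreover have "drop k c = B @ C"
      using append_take_drop_id[of "l + 1 - k" "drop k c"] kl by (simp add: B_def C_def)
    ultimately show ?thesis by simp
  qed
  have len: "k = Suc (length A)" "l = length A + length B"
    using kl Cons.prems by (auto simp: A_def B_def)
  have "take (Suc l) c = take (Suc l) (take (Suc b) c)" using kl by (simp add: min_def)
  then have "sorted_wrt (<) (take (Suc l) c)" using Cons.prems(4) sorted_wrt_take by metis
  moreover have "take (Suc l) c = A @ p # B" by (simp add: c len(2))
  ultimately have s: "sorted_wrt (<) (A @ p # B)" by simp
  then have "\<forall>b\<in>set B. p < b" by (simp add: sorted_wrt_append)
  then have up: "ascending N (up_word k l) c" "run N (up_word k l) c = A @ B @ p # C"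
    using run_up_word[of N A B p C] len c by auto
  have l: "l \<ge> 1" using kl by simp
  have "take l (A @ B @ p # C) = A @ B" by (simp add: len(2))
  moreover have "sorted_wrt (<) (A @ B)" using s by (auto simp: sorted_wrt_append)
  moreover have "\<forall>(k', l')\<in>set kls. 1 \<le> k' \<and> k' \<le> l' \<and> l' \<le> l - 1"
    using Cons.prems(1,2) kl(1) by fastforce
  ultimately have "ascending N (concat (map (\<lambda>(k, l). up_word k l) kls)) (A @ B @ p # C)"
    using Cons.prems(2) l by (intro Cons.IH[of "l - 1"]) (simp_all add: len(2))
  then show ?case using up by (simp add: kl(1) ascending_append)
qed simp

lemma canonical_finite_ascending:
  assumes "canonical_finite N x" "length c = Suc N" "sorted_wrt (<) c"
  shows "ascending N x c"
proof -
  obtain kls where "x = concat (map (\<lambda>(k, l). up_word k l) kls)"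
    "\<forall>(k, l)\<in>set kls. 1 \<le> k \<and> k \<le> l \<and> l \<le> N" "sorted_wrt (\<lambda>p q. snd p > snd q) kls"
    using assms(1) by (auto simp: canonical_finite_def)
  then show ?thesis using assms ascending_descending_up_words[of kls N c N] by simp
qed

lemma canonical_finite_letters:
  assumes "canonical_finite N x"
  shows "set x \<subseteq> Sig ` {1..N}"
proof -
  obtain kls where "x = concat (map (\<lambda>(k, l). up_word k l) kls)"
    "\<forall>(k, l)\<in>set kls. 1 \<le> k \<and> k \<le> l \<and> l \<le> N"
    using assms by (auto simp: canonical_finite_def)
  then show ?thesis by (fastforce simp: up_word_def)
qed

lemma translation_size_run_finite:
  assumes "set x \<subseteq> Sig ` {1..N}" "length c = Suc N"
  shows "translation_size N (run N x c) = translation_size N c"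
  using assms
proof (induction x arbitrary: c)
  case (Cons s x)
  then obtain i where i: "s = Sig i" "1 \<le> i" "i \<le> N" by auto
  then show ?case using Cons translation_size_act_Sig[of i c N] by simp
qed simp

section \<open>The embedding on windows\<close>

text \<open>For \<open>z = r + n d\<close> with \<open>1 \<le> r \<le> n\<close> the quotient is
  \<open>d\<close>, so the value is \<open>r + (n + 1) d\<close>.\<close>

definition stretch :: "nat \<Rightarrow> int \<Rightarrow> int" where
  "stretch n z = z + (z - 1) div int n"

lemma stretch_shift:
  assumes "n \<ge> 1"
  shows "stretch n (z + int n) = stretch n z + int (Suc n)" "stretch n (z - int n) = stretch n z - int (Suc n)"
proof -
  have n: "int n \<noteq> 0" using assms by simp
  show "stretch n (z + int n) = stretch n z + int (Suc n)" for z
    using div_add_self2[OF n, of "z - 1"] by (simp add: stretch_def algebra_simps)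
  from this[of "z - int n"] show "stretch n (z - int n) = stretch n z - int (Suc n)" by simp
qed

lemma id_window_stretch:
  assumes "n \<ge> 1"
  shows "id_window n = map (stretch n) (id_window (n - 1)) @ [int (Suc n)]"
proof -
  have "map (stretch n) (id_window (n - 1)) = id_window (n - 1)"
    using assms by (intro map_idI) (auto simp: id_window_def stretch_def)
  moreover have "id_window n = id_window (n - 1) @ [int (Suc n)]"
    using assms unfolding id_window_def by (subst upto_rec2) (auto simp: of_nat_diff)
  ultimately show ?thesis by simp
qed

text \<open>For \<open>Aff\<close>, the first \<open>Sig n\<close> moves \<open>e\<close> out of the
  last place, \<open>Aff\<close> exchanges the stretched extreme entries with the shift n + 1, and
  the second \<open>Sig n\<close> puts \<open>e\<close> back.\<close>

lemma run_subst_word: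
  assumes n: "n \<ge> 2" and "u \<in> lists (gens (n - 1))" "length c = n"
  shows "run n (subst_word n u) (map (stretch n) c @ [e]) = map (stretch n) (run (n - 1) u c) @ [e]"
  using assms(2,3)
proof (induction u arbitrary: c)
  case Nil
  then show ?case by (simp add: subst_word_def)
next
  case (Cons s u)
  have s: "s \<in> gens (n - 1)" using Cons by auto
  have "run n (subst_word n [s]) (map (stretch n) c @ [e]) = map (stretch n) (act (n - 1) s c) @ [e]"
    using s
  proof (cases rule: gens_cases)
    case (Sig i)
    then have "i < n" "i - 1 < n" using n by auto
    then show ?thesis using Sig Cons.prems
      by (simp add: subst_word_def act_def nth_append list_update_append map_update)
  next
    case Aff
    obtain a R b where c: "c = a # R @ [b]" "n = Suc (Suc (length R))"
      using n Cons.prems by (cases c; cases "tl c" rule: rev_cases) auto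
    define f where "f = stretch n"
    have swap: "act n (Sig n) (a' # R' @ [p, q]) = a' # R' @ [q, p]" if "length R' = length R" for a' R' p q
      using act_Sig_append[of n "a' # R'" p q "[]"] c(2) that by simp
    have 1: "act n Aff (f a # (map f R @ [e]) @ [f b]) = f (b - int n) # (map f R @ [e]) @ [f (a + int n)]"
      using act_Aff[of n "map f R @ [e]"] c(2) stretch_shift[of n] n by (simp add: f_def)
    have 2: "act (n - 1) Aff c = (b - int n) # R @ [a + int n]"
      using act_Aff[of "n - 1" R a b] c by simp
    show ?thesis
      using 1 unfolding Aff 2 f_def[symmetric] by (simp add: subst_word_def swap c(1))
  qed
  then show ?case
    using Cons.IH[of "act (n - 1) s c"] Cons.prems subst_word_append[of n "[s]" u] by simp
qed

lemma subst_word_finite: "set x \<subseteq> range Sig \<Longrightarrow> subst_word n x = x"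
  by (induction x) (auto simp: subst_word_def)

lemma length_subst_word: "length (subst_word n u) = length u + 2 * count_list u Aff"
  by (induction u) (auto simp: subst_word_def)

text \<open>Each block raises one entry by \<open>n\<close>; the raised entry is a new one as long as \<open>i\<^sub>k < n - k\<close>. The
  window of the image is obtained by inserting \<open>n + 1\<close> in front of the \<open>min k s\<close> raised entries.\<close>

lemma block_window_embedding:
  assumes n: "n \<ge> 3" and pw: "pairwise_inequalities (n - 1) m j i"
    and s: "\<And>k. 1 \<le> k \<Longrightarrow> k \<le> m \<Longrightarrow> i k < n - k \<longleftrightarrow> k \<le> s"
    and s1: "\<And>k. s < k \<Longrightarrow> k \<le> m \<Longrightarrow> n \<le> i k + s + 1"
    and i': "i' = (\<lambda>k. if k \<le> s then i k else i k + 1)"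
    and "k \<le> m"
  shows "\<exists>A B. block_window (n - 1) k j i = A @ B \<and>
    block_window n k j i' = map (stretch n) A @ int (Suc n) # map (stretch n) B \<and>
    (\<forall>a\<in>set A. a \<le> int n) \<and> (\<forall>b\<in>set B. int n < b) \<and> length B = min k s"
  using assms(6)
proof (induction k)
  case 0
  show ?case
    unfolding block_window_0 using n id_window_stretch[of n]
    by (intro exI[of _ "id_window (n - 1)"] exI[of _ "[]"]) (auto simp: id_window_def)
next
  case (Suc k)
  define f where "f = stretch n"
  define c where "c = block_window (n - 1) k j i"
  define r ik where "r = j (Suc k)" and "ik = i (Suc k)"
  from Suc obtain C D where CD: "c = C @ D" "block_window n k j i' = map f C @ int (Suc n) # map f D"
    "\<forall>a\<in>set C. a \<le> int n" "\<forall>b\<in>set D. int n < b" "length D = min k s"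
    by (auto simp: c_def f_def)
  have "n - 1 \<ge> 1" "k < m" using n Suc.prems by auto
  then obtain p q R where g: "good_block (n - 1) c r ik p q R"
    using canonical_good_block[OF _ pw, of k] unfolding c_def r_def ik_def by blast
  have Mn: "int (Suc (n - 1)) = int n" using n by simp
  have pq: "p \<le> int n" "1 \<le> q" and lc: "length c = n" and bl: "block c r ik p q R"
    using g n by (auto simp: good_block_def)
  have new: "block_window (n - 1) (Suc k) j i = (p - int n) # R @ [q + int n]"
    unfolding block_window_Suc c_def[symmetric] r_def[symmetric] ik_def[symmetric]
    using good_block_run(1)[OF g] unfolding Mn .
  have Rle: "length R = n - 2" using length_block[OF bl] lc by simp
  obtain A B A' B' where b: "c = A @ p # B" "r = Suc (length A)" "A @ B = A' @ q # B'" "ik = length A'" "R = A' @ B'"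
    using bl by (auto simp: block_def)
  have "p \<in> set C"
    using block_set[OF bl] CD(1,4) pq by auto
  \<comment> \<open>The lowered entry is at most n and all of \<open>D\<close> exceeds n, so
    \<open>p\<close> stands before the inserted entry and keeps its position
    \<open>r\<close>.\<close>
  have "length A < length C"
  proof (rule ccontr)
    assume "\<not> length A < length C"
    moreover have "p = (C @ D) ! length A" "length A < length (C @ D)"
      using b(1) CD(1) by (metis nth_append_length, simp)
    ultimately have "p \<in> set D" by (simp add: nth_append)
    then show False using CD(4) pq by auto
  qed
  then obtain A2 where A2: "C = A @ p # A2" "B = A2 @ D"
    using append_Cons_eq_append_long[of A p B C D] b(1) CD(1) by auto
  have lA: "length (A @ A2) + length D + 1 = n" using lc b(1) A2(2) by simp
  let ?e = "int (Suc n)"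
  have c': "block_window n k j i' = map f A @ f p # (map f A2 @ ?e # map f D)"
    using CD(2) A2 by simp
  have lc': "length (block_window n k j i') = Suc n" by (simp add: block_window_def)
  have fs: "f (p - int n) = f p - ?e" "f (q + int n) = f q + ?e"
    using stretch_shift[of n] n by (simp_all add: f_def)
  have small: "\<forall>a\<in>set (A @ A2). a \<le> int n" using CD(3) A2 by auto
  have pn: "p - int n \<le> int n" "int n < q + int n" using pq by auto
  have rest: "A @ A2 @ D = A' @ q # B'" using b(3) A2 by simp
  show ?case
  proof (cases "Suc k \<le> s")
    case True
    then have "ik < n - Suc k" using s[of "Suc k"] Suc.prems by (simp add: ik_def)
    \<comment> \<open>Apart from \<open>p\<close>, the entries up to n number
      \<open>n - 1 - k\<close>. The bound on \<open>ik\<close> puts \<open>q\<close> among them, so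
      its index is unaffected by the insertion.\<close>
    then have "length A' < length (A @ A2)" using lA CD(5) True b(4) by simp
    then obtain A4 where A4: "A @ A2 = A' @ q # A4" "B' = A4 @ D"
      using append_Cons_eq_append_long[of A' q B' "A @ A2" D] rest by auto
    have "map f A @ (map f A2 @ ?e # map f D) = map f A' @ f q # (map f A4 @ ?e # map f D)"
      using arg_cong[OF A4(1), of "map f"] by simp
    then have "block (block_window n k j i') r ik (f p) (f q) (map f A' @ map f A4 @ ?e # map f D)"
      unfolding block_def c' using b(2,4)
      by (intro exI[of _ "map f A"] exI[of _ "map f A2 @ ?e # map f D"] exI[of _ "map f A'"]
          exI[of _ "map f A4 @ ?e # map f D"]) auto
    from run_block(1)[OF this lc'] have "block_window n (Suc k) j i' =
      (f p - ?e) # map f A' @ map f A4 @ ?e # map f D @ [f q + ?e]"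
      using True by (simp add: block_window_Suc r_def ik_def i')
    then show ?thesis
      unfolding new b(5) A4(2) f_def[symmetric]
      using small pn CD(4,5) True A4(1) fs
      by (intro exI[of _ "(p - int n) # A' @ A4"] exI[of _ "D @ [q + int n]"]) auto
  next
    case False
    then have "n \<le> ik + s + 1" using s1[of "Suc k"] Suc.prems by (simp add: ik_def)
    \<comment> \<open>Now \<open>q\<close> lies in \<open>D\<close>, behind the inserted entry. Its
      index grows by one, and the number of entries above n stays \<open>s\<close>.\<close>
    then have "length (A @ A2) \<le> length A'" using lA CD(5) False b(4) by simp
    then obtain B4 where B4: "A' = A @ A2 @ B4" "D = B4 @ q # B'"
      using append_Cons_eq_append_short[of A' q B' "A @ A2" D] rest by auto
    have "map f A @ (map f A2 @ ?e # map f D) = (map f A @ map f A2 @ ?e # map f B4) @ f q # map f B'"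
      using B4(2) by simp
    then have "block (block_window n k j i') r (Suc ik) (f p) (f q) ((map f A @ map f A2 @ ?e # map f B4) @ map f B')"
      unfolding block_def c' using b(2,4) B4(1)
      by (intro exI[of _ "map f A"] exI[of _ "map f A2 @ ?e # map f D"]
          exI[of _ "map f A @ map f A2 @ ?e # map f B4"] exI[of _ "map f B'"]) auto
    from run_block(1)[OF this lc'] have "block_window n (Suc k) j i' =
      (f p - ?e) # map f A @ map f A2 @ ?e # map f B4 @ map f B' @ [f q + ?e]"
      using False by (simp add: block_window_Suc r_def ik_def i')
    then show ?thesis
      unfolding new b(5) B4(1) f_def[symmetric]
      using small pn CD(4,5) False B4(2) fs
      by (intro exI[of _ "(p - int n) # A @ A2"] exI[of _ "B4 @ B' @ [q + int n]"]) auto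
  qed
qed

section \<open>Lengths and affine lengths\<close>

text \<open>The inversion number of the common final window bounds the length of every expression
  from below, and an ascending word attains it.\<close>

lemma cox_length_ascending:
  assumes N: "N \<ge> 2" and u: "u \<in> lists (gens N)" "ascending N u (id_window N)"
  shows "cox_length (word_class N u) = length u"
proof -
  have N1: "N \<ge> 1" using N by simp
  have "u \<in> word_class N u" using u by (simp add: word_class_def cox_class_def cox_refl)
  moreover have "length u \<le> length v" if "v \<in> word_class N u" for v
  proof -
    have eq: "cox_eq (gens N) (affine_matrix N) u v"
      using that by (simp add: word_class_def cox_class_def)
    have v: "v \<in> lists (gens N)" using cox_eq_lists[OF eq] by simp
    have "int (length u) = inversions N (run N u (id_window N))"
      using u ascending_iff_inversions[OF N1 window_id u(1)] by (simp add: inversions_id)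
    also have "\<dots> = inversions N (run N v (id_window N))"
      using cox_eq_run[OF eq N] by simp
    also have "\<dots> \<le> int (length v)"
      using inversions_run_le[OF N1 window_id v] by (simp add: inversions_id)
    finally show ?thesis by simp
  qed
  ultimately show ?thesis
    unfolding cox_length_def by (intro Least_equality) auto
qed

lemma reduced_expression_iff_ascending:
  assumes N: "N \<ge> 2" and u: "u \<in> lists (gens N)" "ascending N u (id_window N)"
  shows "reduced_expression (word_class N u) v \<longleftrightarrow> v \<in> word_class N u \<and> length v = length u"
  by (simp add: reduced_expression_def cox_length_ascending[OF assms])

text \<open>All expressions share one final window, whose translation size bounds the occurrences of
  \<open>Aff\<close>; the assumption \<open>count\<close> says that \<open>u\<close> attains the
  bound.\<close>

lemma affine_length_ascending:
  assumes N: "N \<ge> 2" and u: "u \<in> lists (gens N)" "ascending N u (id_window N)"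
    and count: "translation_size N (run N u (id_window N)) = int (count_list u Aff)"
  shows "affine_length (word_class N u) = count_list u Aff"
proof -
  have "u \<in> word_class N u" using u by (simp add: word_class_def cox_class_def cox_refl)
  then have "reduced_expression (word_class N u) u"
    by (simp add: reduced_expression_iff_ascending[OF N u])
  moreover have "count_list u Aff \<le> count_list v Aff" if "reduced_expression (word_class N u) v" for v
  proof -
    have eq: "cox_eq (gens N) (affine_matrix N) u v"
      using that by (simp add: reduced_expression_def word_class_def cox_class_def)
    have v: "v \<in> lists (gens N)" using cox_eq_lists[OF eq] by simp
    have "int (count_list u Aff) = translation_size N (run N v (id_window N))"
      using cox_eq_run[OF eq N] count by simp
    also have "\<dots> \<le> int (count_list v Aff)"
      using translation_size_run_le[of N "id_window N" v] v N by (simp add: translation_size_id)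
    finally show ?thesis by simp
  qed
  ultimately show ?thesis
    unfolding affine_length_def by (intro Least_equality) auto
qed

section \<open>Canonical words are reduced\<close>

lemma h_word_gens: "1 \<le> r \<Longrightarrow> i \<le> N \<Longrightarrow> set (h_word N r i) \<subseteq> Sig ` {1..N}"
  by (auto simp: h_word_def up_word_def down_word_def)

lemma count_list_Aff: "set u \<subseteq> Sig ` A \<Longrightarrow> count_list u Aff = 0"
  by (induction u) auto

lemma pairwise_bounds:
  assumes "pairwise_inequalities N m j i" "1 \<le> k" "k \<le> m"
  shows "1 \<le> j k" "j k \<le> N + 1" "i k \<le> N - 1"
proof -
  have "1 \<le> j k \<and> j k \<le> N + 1 \<and> i k \<le> N - 1"
  proof (cases "k = 1")
    case False
    then have "k \<in> {2..m}" using assms by simp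
    then show ?thesis using assms(1) unfolding pairwise_inequalities_def by fastforce
  qed (use assms(1) in \<open>simp add: pairwise_inequalities_def\<close>)
  then show "1 \<le> j k" "j k \<le> N + 1" "i k \<le> N - 1" by auto
qed

lemma pairwise_mono:
  assumes "pairwise_inequalities N m j i" "1 \<le> k" "k \<le> l" "l \<le> m"
  shows "i k \<le> i l"
  using assms(3,4)
proof (induction l rule: dec_induct)
  case (step l)
  then have "Suc l \<in> {2..m}" using assms(2) by simp
  then have "i (Suc l - 1) \<le> i (Suc l)" using assms(1) unfolding pairwise_inequalities_def by blast
  then show ?case using step by simp
qed simp

lemma affine_word_gens:
  assumes "\<And>k. 1 \<le> k \<Longrightarrow> k \<le> m \<Longrightarrow> 1 \<le> j k \<and> i k \<le> N" "set x \<subseteq> Sig ` {1..N}"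
  shows "affine_word N m j i x \<in> lists (gens N)" "count_list (affine_word N m j i x) Aff = m"
proof -
  have "affine_word N m j i [] \<in> lists (gens N) \<and> count_list (affine_word N m j i []) Aff = m"
    using assms(1)
  proof (induction m)
    case (Suc m)
    have "set (h_word N (j (Suc m)) (i (Suc m))) \<subseteq> Sig ` {1..N}"
      using Suc.prems[of "Suc m"] by (intro h_word_gens) auto
    then show ?case
      using Suc count_list_Aff[of "h_word N (j (Suc m)) (i (Suc m))" "{1..N}"]
      by (auto simp: affine_word_Suc gens_def in_lists_conv_set)
  qed (simp add: affine_word_0)
  moreover have "x \<in> lists (gens N)" using assms(2) by (auto simp: gens_def in_lists_conv_set)
  ultimately show "affine_word N m j i x \<in> lists (gens N)" "count_list (affine_word N m j i x) Aff = m"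
    using count_list_Aff[OF assms(2)] by (simp_all add: affine_word_append[of N m j i x])
qed

lemma canonical_word:
  assumes N: "N \<ge> 2" and pw: "pairwise_inequalities N m j i" and x: "canonical_finite N x"
  shows "affine_word N m j i x \<in> lists (gens N)"
    and "count_list (affine_word N m j i x) Aff = m"
    and "ascending N (affine_word N m j i x) (id_window N)"
    and "affine_length (word_class N (affine_word N m j i x)) = m"
proof -
  have N1: "N \<ge> 1" using N by simp
  have "1 \<le> j k \<and> i k \<le> N" if "1 \<le> k" "k \<le> m" for k
    using pairwise_bounds[OF pw that] by auto
  note gw = affine_word_gens[of m j i N, OF this canonical_finite_letters[OF x]]
  show "affine_word N m j i x \<in> lists (gens N)" "count_list (affine_word N m j i x) Aff = m"
    using gw by auto
  have asc: "ascending N (affine_word N m j i x) (id_window N)"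
    unfolding affine_word_append[of N m j i x] ascending_append block_window_def[symmetric]
    using canonical_blocks_ascending[OF N1 pw order_refl]
      canonical_finite_ascending[OF x _ canonical_blocks_sorted[OF N1 pw order_refl]]
    by (simp add: block_window_def)
  then show "ascending N (affine_word N m j i x) (id_window N)" .
  have "translation_size N (run N (affine_word N m j i x) (id_window N)) = int m"
    unfolding affine_word_append[of N m j i x] run_simps block_window_def[symmetric]
    using translation_size_run_finite[OF canonical_finite_letters[OF x], of "block_window N m j i"]
      canonical_blocks_translation_size[OF N1 pw order_refl]
    by (simp add: block_window_def)
  then show "affine_length (word_class N (affine_word N m j i x)) = m"
    using affine_length_ascending[OF N _ asc] gw by simp
qed

lemma length_up_word: "length (up_word k l) = Suc l - k"
  unfolding up_word_def by (simp only: length_map length_upt)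

lemma length_affine_word:
  "length (affine_word N m j i x) = (\<Sum>k=1..m. Suc N - j k + i k + 1) + length x"
proof -
  have "length (down_word k 1) = k" for k by (simp add: down_word_def)
  then have "length (affine_word N m j i []) = (\<Sum>k=1..m. Suc N - j k + i k + 1)"
    by (induction m) (simp_all add: affine_word_0 affine_word_Suc h_word_def length_up_word)
  then show ?thesis by (simp add: affine_word_append[of N m j i x])
qed

text \<open>Raising \<open>i\<close> by one beyond \<open>s\<close> only strengthens the premises of
  the last two conditions and preserves strict increases. A pair with \<open>i k = 0\<close> and
  \<open>j k = 1\<close> becomes \<open>(1, 1)\<close>, which falls under the other
  alternative.\<close>

lemma embedded_inequalities:
  assumes n: "n \<ge> 3" and pw: "pairwise_inequalities (n - 1) m j i" and "s \<ge> 1"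
    and i': "i' = (\<lambda>k. if k \<le> s then i k else i k + 1)"
  shows "pairwise_inequalities n m j i'"
  unfolding pairwise_inequalities_def
proof (intro conjI ballI)
  show "1 \<le> j 1" "j 1 \<le> n + 1" "i' 1 \<le> n - 1"
    using pw n assms(3) by (auto simp: pairwise_inequalities_def i')
next
  fix k assume k: "k \<in> {2..m}"
  have p: "(i k = 0 \<and> j k = 1) \<or> (1 \<le> i k \<and> i k \<le> n - 1 - 1 \<and> 1 \<le> j k \<and> j k \<le> n - 1)"
    "j k \<le> j (k - 1)" "i (k - 1) \<le> i k" "j (k - 1) > i (k - 1) + 1 \<longrightarrow> j k < j (k - 1)"
    "j k > i k + 1 \<longrightarrow> i (k - 1) < i k"
    using pw k unfolding pairwise_inequalities_def by blast+
  show "(i' k = 0 \<and> j k = 1) \<or> (1 \<le> i' k \<and> i' k \<le> n - 1 \<and> 1 \<le> j k \<and> j k \<le> n)"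
    "j k \<le> j (k - 1)" "i' (k - 1) \<le> i' k" "i' (k - 1) + 1 < j (k - 1) \<longrightarrow> j k < j (k - 1)"
    "i' k + 1 < j k \<longrightarrow> i' (k - 1) < i' k"
    using p n by (auto simp: i')
qed

lemma canonical_finite_prepend:
  assumes "canonical_finite (n - 1) x" "1 \<le> t" "t \<le> n"
  shows "canonical_finite n (up_word t n @ x)"
proof -
  obtain kls where "x = concat (map (\<lambda>(k, l). up_word k l) kls)"
    "\<forall>(k, l)\<in>set kls. 1 \<le> k \<and> k \<le> l \<and> l \<le> n - 1" "sorted_wrt (\<lambda>p q. snd p > snd q) kls"
    using assms(1) by (auto simp: canonical_finite_def)
  then show ?thesis
    unfolding canonical_finite_def using assms by (intro exI[of _ "(t, n) # kls"]) fastforce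
qed

theorem theorem5p5:
  fixes n m :: nat and j i i' :: "nat \<Rightarrow> nat" and x :: "gen list" and w :: "gen list set"
    and s t :: nat
  assumes "n \<ge> 3"
    and "w \<in> carrier (affine_group (n - 1))"
    and "canonical_expression (n - 1) w m j i x"
    and "s = Max {k. 1 \<le> k \<and> k \<le> m \<and> i k < n - k}"
    and "i' = (\<lambda>k. if k \<le> s then i k else i k + 1)"
    and "t = n - s + 1"
  shows
    "reduced_expression (affine_embedding n w) (subst_word n (affine_word (n - 1) m j i x)) \<and>
     (braid_move (gens n) (affine_matrix n))\<^sup>*\<^sup>*
        (subst_word n (affine_word (n - 1) m j i x))
        (affine_word n m j i' (up_word t n @ x)) \<and>
     canonical_expression n (affine_embedding n w) m j i' (up_word t n @ x) \<and>
     reduced_expression (affine_embedding n w) (affine_word n m j i' (up_word t n @ x)) \<and>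
     affine_length (affine_embedding n w) = affine_length w \<and>
     cox_length (affine_embedding n w) = cox_length w + 2 * affine_length w \<and>
     (\<forall>u. reduced_expression w u \<longrightarrow>
        (reduced_expression (affine_embedding n w) (subst_word n u) \<longleftrightarrow> affine_length_reduced w u))"
proof -
  note n = assms(1) and i' = assms(5)
  define v where "v = affine_word (n - 1) m j i x"
  define V where "V = affine_word n m j i' (up_word t n @ x)"
  define U where "U = subst_word n v"
  have n2: "n - 1 \<ge> 2" "n \<ge> 2" "n \<ge> 1" using n by auto
  have can: "1 \<le> m" "affine_length w = m" "v \<in> w" "pairwise_inequalities (n - 1) m j i" "canonical_finite (n - 1) x"
    using assms(3) by (auto simp: canonical_expression_def v_def)
  note pw = can(4)
  note cv = canonical_word[OF n2(1) pw can(5), folded v_def]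
  have i1: "i 1 \<le> n - 2" using pw unfolding pairwise_inequalities_def by linarith
  define K where "K = {k. 1 \<le> k \<and> k \<le> m \<and> i k < n - k}"
  \<comment> \<open>Since \<open>i 1 \<le> n - 2\<close>, the set is nonempty and \<open>Max\<close>
    is meaningful.\<close>
  have K: "finite K" "1 \<in> K" using can(1) i1 n by (auto simp: K_def)
  have sK: "s = Max K" by (simp add: assms(4) K_def)
  have "s \<in> K" unfolding sK using K by (intro Max_in) auto
  then have s: "1 \<le> s" "s \<le> m" "i s < n - s" by (auto simp: K_def)
  \<comment> \<open>As \<open>i\<close> increases weakly and \<open>n - k\<close> decreases, the set
    is an initial segment.\<close>
  have s_iff: "i k < n - k \<longleftrightarrow> k \<le> s" if "1 \<le> k" "k \<le> m" for k
  proof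
    assume "i k < n - k"
    then have "k \<in> K" using that by (simp add: K_def)
    then show "k \<le> s" unfolding sK using K by simp
  next
    assume "k \<le> s"
    then show "i k < n - k" using pairwise_mono[OF pw that(1) _ s(2)] s(3) by force
  qed
  have s1: "n \<le> i k + s + 1" if "s < k" "k \<le> m" for k
  proof -
    have "i (Suc s) \<le> i k" using pairwise_mono[OF pw, of "Suc s" k] that by simp
    moreover have "\<not> i (Suc s) < n - Suc s" using s_iff[of "Suc s"] that by simp
    ultimately show ?thesis by simp
  qed
  have t: "2 \<le> t" "t \<le> n" using s assms(6) by auto
  have pw': "pairwise_inequalities n m j i'" by (rule embedded_inequalities[OF n pw s(1) i'])
  have x': "canonical_finite n (up_word t n @ x)"
    using canonical_finite_prepend[OF can(5)] t by simp
  note cV = canonical_word[OF n2(2) pw' x', folded V_def]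
  have U: "U \<in> lists (gens n)" unfolding U_def by (rule subst_word_lists[OF n cv(1)])
  have jn: "j k \<le> n" if "1 \<le> k" "k \<le> m" for k
    using pairwise_bounds[OF pw that] n by simp
  have xs: "set x \<subseteq> Sig ` {1..n - 1}" by (rule canonical_finite_letters[OF can(5)])
  \<comment> \<open>After the image blocks n + 1 stands at position \<open>t\<close>, because
    \<open>s\<close> entries follow it. \<open>up_word t n\<close> moves it to the end, where
    \<open>x\<close> leaves it.\<close>
  have run_eq: "run n U (id_window n) = run n V (id_window n)"
  proof -
    obtain A B where AB: "block_window (n - 1) m j i = A @ B"
      "block_window n m j i' = map (stretch n) A @ int (Suc n) # map (stretch n) B" "length B = min m s"
      using block_window_embedding[OF n pw s_iff s1 i' order_refl] by blast
    have "length (A @ B) = n" unfolding AB(1)[symmetric] using n by (simp add: block_window_def)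
    then have len: "length A + length B = n" "t = Suc (length A)"
      using AB(3) s assms(6) by auto
    have xl: "x \<in> lists (gens (n - 1))" using xs by (auto simp: gens_def)
    have sx: "subst_word n x = x" by (rule subst_word_finite) (use xs in auto)
    have "run n U (id_window n) = map (stretch n) (run (n - 1) v (id_window (n - 1))) @ [int (Suc n)]"
      unfolding U_def id_window_stretch[OF n2(3)] using n by (intro run_subst_word[OF n2(2) cv(1)]) simp
    also have "run (n - 1) v (id_window (n - 1)) = run (n - 1) x (A @ B)"
      unfolding v_def affine_word_append[of "n - 1" m j i x] run_simps block_window_def[symmetric] AB(1) ..
    also have "map (stretch n) \<dots> @ [int (Suc n)] = run n x (map (stretch n) (A @ B) @ [int (Suc n)])"
      using run_subst_word[OF n2(2) xl, of "A @ B" "int (Suc n)"] len(1) by (simp add: sx)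
    also have "map (stretch n) (A @ B) @ [int (Suc n)] = run n (up_word t n) (block_window n m j i')"
      using run_up_word[of n "map (stretch n) A" "map (stretch n) B" "int (Suc n)" "[]"] len
      unfolding AB(2) by simp
    also have "run n x \<dots> = run n V (id_window n)"
      unfolding V_def affine_word_append[of n m j i' "up_word t n @ x"] run_simps block_window_def ..
    finally show ?thesis .
  qed
  have lenU: "length U = length v + 2 * m" by (simp add: U_def length_subst_word cv(2))
  \<comment> \<open>Per block, the substitution adds two letters to \<open>U\<close>, whereas
    \<open>V\<close> gains one from the longer \<open>up_word\<close> and one more only for
    \<open>k > s\<close>. The deficit \<open>s\<close> is the length of \<open>up_word t n\<close>.
    The bound \<open>jn\<close> keeps natural subtraction exact.\<close>
  have len_eq: "length U = length V"
  proof -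
    have "length v + 2 * m = (\<Sum>k=1..m. n - j k + i k + 1 + 2) + length x"
    proof -
      have "(\<Sum>k=1..m. n - j k + i k + 1 + 2) = (\<Sum>k=1..m. n - j k + i k + 1) + 2 * m"
        by (subst sum.distrib) simp
      then show ?thesis using n by (simp add: v_def length_affine_word)
    qed
    moreover have "length V = (\<Sum>k=1..m. Suc n - j k + i' k + 1) + (s + length x)"
      using s assms(6) by (simp add: V_def length_affine_word length_up_word)
    moreover have "(\<Sum>k=1..m. n - j k + i k + 1 + 2) = (\<Sum>k=1..m. Suc n - j k + i' k + 1) + s"
    proof -
      have "(\<Sum>k=1..m. n - j k + i k + 1 + 2) = (\<Sum>k=1..m. (Suc n - j k + i' k + 1) + (if k \<le> s then 1 else 0))"
      proof (rule sum.cong)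
        show "n - j k + i k + 1 + 2 = (Suc n - j k + i' k + 1) + (if k \<le> s then 1 else 0)" if "k \<in> {1..m}" for k
          using jn[of k] that by (simp add: i')
      qed simp
      also have "\<dots> = (\<Sum>k=1..m. Suc n - j k + i' k + 1) + card ({1..m} \<inter> {k. k \<le> s})"
        by (simp only: sum.distrib) (simp add: sum.If_cases)
      also have "{1..m} \<inter> {k. k \<le> s} = {1..s}" using s by auto
      finally show ?thesis by simp
    qed
    ultimately show ?thesis using lenU by simp
  qed
  \<comment> \<open>\<open>V\<close> is ascending, and \<open>U\<close> has the same length and the
    same final window.\<close>
  have ascU: "ascending n U (id_window n)"
    using ascending_iff_inversions[OF n2(3) window_id U] ascending_iff_inversions[OF n2(3) window_id cV(1)]
      cV(3) run_eq len_eq by simp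
  have braid: "braid_equiv n U V"
    by (rule ascending_braid_equiv[OF n2(2) U cV(1) ascU cV(3) run_eq])
  have w: "w = word_class (n - 1) v"
  proof -
    obtain u where u: "u \<in> lists (gens (n - 1))" "w = word_class (n - 1) u"
      using assms(2) by (auto simp: affine_group_def coxeter_group_def word_class_def)
    then show ?thesis
      using can(3) by (auto simp: word_class_def cox_class_def intro!: cox_class_eqI[unfolded cox_class_def])
  qed
  have Rw: "affine_embedding n w = word_class n U"
    unfolding w U_def by (rule affine_embedding_word_class[OF n cv(1)])
  have UV: "word_class n U = word_class n V"
    using braid_equiv_cox_eq[OF n2(3) braid U] by (simp add: word_class_def cox_class_eqI)
  have mem: "U \<in> word_class n U" "V \<in> word_class n U"
    using U cV(1) UV by (auto simp: word_class_def cox_class_def intro: cox_refl)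
  note red = reduced_expression_iff_ascending[OF n2(2) U ascU]
  have aff: "affine_length (word_class n U) = m" using cV(4) UV by simp
  \<comment> \<open>All reduced expressions of \<open>w\<close> have equal length, so the length of
    the substituted word depends only on the number of \<open>Aff\<close>; it is minimal exactly
    when this number is \<open>m\<close>.\<close>
  have subst: "reduced_expression (word_class n U) (subst_word n u) \<longleftrightarrow> affine_length_reduced w u"
    if "reduced_expression w u" for u
  proof -
    have u: "u \<in> w" "length u = length v"
      using that reduced_expression_iff_ascending[OF n2(1) cv(1,3)] unfolding w by auto
    then have "subst_word n u \<in> affine_embedding n w"
    proof -
      have "u \<in> lists (gens (n - 1))"
        using u(1) unfolding w word_class_def cox_class_def by (auto dest: cox_eq_lists)
      then have "subst_word n u \<in> word_class n (subst_word n u)"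
        using subst_word_lists[OF n] by (simp add: word_class_def cox_class_def cox_refl)
      then show ?thesis using u(1) by (auto simp: affine_embedding_def)
    qed
    then show ?thesis
      using that u lenU by (auto simp: red affine_length_reduced_def can(2) length_subst_word Rw)
  qed
  have len_w: "cox_length w = length v"
    unfolding w by (rule cox_length_ascending[OF n2(1) cv(1,3)])
  have canR: "canonical_expression n (word_class n U) m j i' (up_word t n @ x)"
    using can(1) aff mem(2) pw' x' by (simp add: canonical_expression_def V_def)
  show ?thesis
    unfolding v_def[symmetric] V_def[symmetric] U_def[symmetric] Rw
    using red mem len_eq braid canR aff can(2) len_w lenU subst
      cox_length_ascending[OF n2(2) U ascU] by simp
qed

end
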